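(* Let $k\geq2$ and $\ell\geq3$ be integers. For every integer $t$ with $k\leq t<k+\ell-2$, as $n\to\infty$, \[\mathrm{ex}(n,K^k_t,\mathcal{S}^kC_\ell)=\Omega\bigl(n^{k-1+1/(\ell-1)}\bigr)\] and \[\mathrm{ex}(n,K^k_t,\mathcal{S}^kC_\ell)=\begin{cases} O(n^k) & \text{if $\ell$ is odd,}\\ O(n^{k-1+2/\ell}) & \text{if $\ell$ is even,} \end{cases}\] where the implied constants may depend on $k,\ell,t$ but not on $n$.
   Context: For an integer $k\geq2$ and a graph $F$, the $k$-uniform suspension $\mathcal{S}^kF$ is the $k$-uniform hypergraph with vertex set $S\cup V(F)$ and edge set $\{S\cup e:\,e\in E(F)\}$, where $S$ is a set of size $k-2$ disjoint from $V(F)$. $C_\ell$ is the cycle of length $\ell$. $K^k_t$ is the $k$-uniform clique of order $t$, i.e. the hypergraph on $t$ vertices whose edges are all $k$-element subsets. A $k$-uniform hypergraph is $H$-free if it contains no (not necessarily induced) subhypergraph isomorphic to $H$; a copy of $T$ is a subhypergraph isomorphic to $T$. For $k$-uniform hypergraphs $T$ and $H$, $\mathrm{ex}(n,T,H)$ is the maximum number of copies of $T$ in an $n$-vertex $H$-free $k$-uniform hypergraph. *)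

theory Defs
  imports Complex_Main "HOL-Library.Landau_Symbols"
begin

datatype 'a hypergraph = Hypergraph (verts: "'a set") (edges: "'a set set")

definition uniform_hypergraph :: "nat \<Rightarrow> 'a hypergraph \<Rightarrow> bool" where
  "uniform_hypergraph k G \<longleftrightarrow>
     finite (verts G) \<and> (\<forall>e\<in>edges G. e \<subseteq> verts G \<and> card e = k)"

definition subhypergraph :: "'a hypergraph \<Rightarrow> 'a hypergraph \<Rightarrow> bool" where
  "subhypergraph G' G \<longleftrightarrow> verts G' \<subseteq> verts G \<and> edges G' \<subseteq> edges G"

definition isomorphic :: "'a hypergraph \<Rightarrow> 'b hypergraph \<Rightarrow> bool" where
  "isomorphic G H \<longleftrightarrow>
     (\<exists>f. bij_betw f (verts G) (verts H) \<and> edges H = (\<lambda>e. f ` e) ` edges G)"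

definition copies :: "'a hypergraph \<Rightarrow> 'b hypergraph \<Rightarrow> 'b hypergraph set" where
  "copies T G = {G'. subhypergraph G' G \<and> isomorphic T G'}"

definition free_of :: "'a hypergraph \<Rightarrow> 'b hypergraph \<Rightarrow> bool" where
  "free_of H G \<longleftrightarrow> copies H G = {}"

text \<open>The vertices of the host hypergraphs are natural numbers; as every finite hypergraph is
  isomorphic to one of these, this does not affect the maximum.\<close>

definition copy_counts ::
  "nat \<Rightarrow> nat \<Rightarrow> 'a hypergraph \<Rightarrow> 'b hypergraph \<Rightarrow> nat set" where
  "copy_counts k n T H =
     {card (copies T G) | G :: nat hypergraph.
        uniform_hypergraph k G \<and> card (verts G) = n \<and> free_of H G}"

definition ex_num :: "nat \<Rightarrow> nat \<Rightarrow> 'a hypergraph \<Rightarrow> 'b hypergraph \<Rightarrow> nat" where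
  "ex_num k n T H = Max (copy_counts k n T H)"

definition clique :: "nat \<Rightarrow> nat \<Rightarrow> nat hypergraph" where
  "clique k t = Hypergraph {..<t} {e. e \<subseteq> {..<t} \<and> card e = k}"

definition cycle_graph :: "nat \<Rightarrow> nat hypergraph" where
  "cycle_graph l = Hypergraph {..<l} {{i, (i + 1) mod l} | i. i < l}"

text \<open>The additional vertex set is \<open>Inl ` {..<k - 2}\<close>; the vertices of \<open>F\<close> are tagged by \<open>Inr\<close>,
  which makes the two disjoint.\<close>

definition suspension :: "nat \<Rightarrow> 'a hypergraph \<Rightarrow> (nat + 'a) hypergraph" where
  "suspension k F =
     Hypergraph (Inl ` {..<k - 2} \<union> Inr ` verts F)
                {Inl ` {..<k - 2} \<union> Inr ` e | e. e \<in> edges F}"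

text \<open>The maximum in \<^const>\<open>ex_num\<close> ranges over a finite set, which is nonempty whenever
  \<open>H\<close> has an edge.\<close>

lemma finite_copy_counts: "finite (copy_counts k n T H)"
proof -
  have "card (copies T G) \<le> 2 ^ n * 2 ^ 2 ^ n"
    if G: "uniform_hypergraph k G" "card (verts G) = n" for G :: "nat hypergraph"
  proof -
    let ?P = "Pow (verts G) \<times> Pow (Pow (verts G))"
    have fin: "finite ?P" using G by (simp add: uniform_hypergraph_def)
    have "copies T G \<subseteq> (\<lambda>(V, E). Hypergraph V E) ` ?P"
    proof
      fix G' assume "G' \<in> copies T G"
      then have "verts G' \<subseteq> verts G" "edges G' \<subseteq> Pow (verts G)"
        using G by (auto simp: copies_def subhypergraph_def uniform_hypergraph_def)
      then show "G' \<in> (\<lambda>(V, E). Hypergraph V E) ` ?P"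
        by (intro image_eqI[of _ _ "(verts G', edges G')"]) auto
    qed
    then have "card (copies T G) \<le> card ?P"
      by (rule surj_card_le[OF fin])
    also have "\<dots> = 2 ^ n * 2 ^ 2 ^ n"
      using G by (simp add: card_cartesian_product card_Pow uniform_hypergraph_def)
    finally show ?thesis .
  qed
  then have "copy_counts k n T H \<subseteq> {..2 ^ n * 2 ^ 2 ^ n}"
    by (auto simp: copy_counts_def)
  then show ?thesis using finite_subset by blast
qed

lemma copy_counts_nonempty:
  assumes "edges H \<noteq> {}"
  shows "copy_counts k n T H \<noteq> {}"
proof -
  let ?G = "Hypergraph {..<n} {} :: nat hypergraph"
  have "uniform_hypergraph k ?G" "card (verts ?G) = n" "free_of H ?G"
    using assms
    by (auto simp: uniform_hypergraph_def free_of_def copies_def subhypergraph_def isomorphic_def)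
  then show ?thesis unfolding copy_counts_def by blast
qed

end

theory Submission
  imports Defs
begin

text \<open>Lower bound: take a maximal family \<open>F\<close> of \<open>t\<close>-sets in which every \<open>(k - 1)\<close>-set has degree at
  most \<open>d\<close>, a small multiple of \<open>n powr (1 / (l - 1))\<close>, and whose \<open>k\<close>-shadow is free of the suspended cycle. A \<open>t\<close>-set is
  too small to contain the suspended cycle, so a \<open>t\<close>-set that cannot be added to \<open>F\<close> either contains
  a \<open>(k - 1)\<close>-set of full degree, or contains a \<open>(k - 2)\<close>-set \<open>S\<close> and two vertices joined by fewer
  than \<open>l\<close> steps in the link of \<open>S\<close>. The second kind makes up less than half of all \<open>t\<close>-sets, and the
  first kind is bounded in terms of \<open>card F\<close>.

  Upper bound: each \<open>t\<close>-clique contains a \<open>(t - k + 2)\<close>-clique in the link of one of its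
  \<open>(k - 2)\<close>-subsets, and all links are graphs without \<open>l\<close>-cycles. In such a graph the neighbourhoods
  have no path on \<open>l - 1\<close> vertices, hence are degenerate, so the number of cliques is at most
  proportional to the number of edges. For even \<open>l\<close> the latter is bounded by the theorem of Bondy and
  Simonovits, proved by breadth-first search in a subgraph of large minimum degree.\<close>

section \<open>Cliques in graphs without a cycle of fixed length\<close>

text \<open>A graph is a relation on a whole type and the vertex set is a separate argument, so
  passing to an induced subgraph only changes \<open>U\<close>.\<close>

definition nbrs :: "('a \<Rightarrow> 'a \<Rightarrow> bool) \<Rightarrow> 'a set \<Rightarrow> 'a \<Rightarrow> 'a set" where
  "nbrs E U x = {y \<in> U. E x y}"

definition clique_sets :: "('a \<Rightarrow> 'a \<Rightarrow> bool) \<Rightarrow> nat \<Rightarrow> 'a set \<Rightarrow> 'a set set" where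
  "clique_sets E s V = {B. B \<subseteq> V \<and> card B = s \<and> (\<forall>x\<in>B. \<forall>y\<in>B. x \<noteq> y \<longrightarrow> E x y)}"

text \<open>The list gives the vertices in cyclic order. They may be any elements of the type, so
  excluding a cycle excludes it from every induced subgraph at once.\<close>

definition has_cycle :: "('a \<Rightarrow> 'a \<Rightarrow> bool) \<Rightarrow> nat \<Rightarrow> bool" where
  "has_cycle E l \<longleftrightarrow>
     (\<exists>xs. length xs = l \<and> distinct xs \<and> successively E xs \<and> E (last xs) (hd xs))"

section \<open>Degenerate graphs: counting cliques and edges\<close>

lemma finite_nbrs [simp]: "finite U \<Longrightarrow> finite (nbrs E U x)"
  by (simp add: nbrs_def)

text \<open>Repeatedly deleting a vertex of small degree empties \<open>V\<close>. Read backwards,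
  \<open>V\<close> is built up by vertices that have fewer than \<open>D\<close> neighbours among
  those already present.\<close>

lemma degenerate_induct:
  assumes "finite V"
    and deg: "\<And>U. U \<subseteq> V \<Longrightarrow> U \<noteq> {} \<Longrightarrow> \<exists>v\<in>U. card (nbrs E U v) < D"
    and empty: "P {}"
    and step: "\<And>U v. \<lbrakk>U \<subseteq> V; v \<in> V; v \<notin> U; card (nbrs E (insert v U) v) < D; P U\<rbrakk>
                 \<Longrightarrow> P (insert v U)"
  shows "P V"
proof -
  have "U \<subseteq> V \<longrightarrow> P U" if "finite U" for U
    using that
  proof (induction rule: finite_psubset_induct)
    case (psubset U)
    show ?case
    proof (cases "U = {}")
      case False
      show ?thesis
      proof
        assume UV: "U \<subseteq> V"
        then obtain v where v: "v \<in> U" "card (nbrs E U v) < D"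
          using deg False by blast
        have "P (U - {v})"
          using psubset.IH[of "U - {v}"] v UV by blast
        moreover have "insert v (U - {v}) = U" using v by blast
        ultimately show "P U"
          using step[of "U - {v}" v] v UV by auto
      qed
    qed (simp add: empty)
  qed
  then show ?thesis using \<open>finite V\<close> by blast
qed

text \<open>A clique that appears when \<open>v\<close> is added consists of \<open>v\<close> and a
  subset of its fewer than \<open>D\<close> earlier neighbours, so each vertex contributes at most
  \<open>2 ^ D\<close> cliques. The condition \<open>s \<ge> 1\<close> makes the count zero on the
  empty set.\<close>

lemma degenerate_card_cliques:
  assumes "finite V" and "s \<ge> 1"
    and deg: "\<And>U. U \<subseteq> V \<Longrightarrow> U \<noteq> {} \<Longrightarrow> \<exists>v\<in>U. card (nbrs E U v) < D"
  shows "card (clique_sets E s V) \<le> 2 ^ D * card V"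
proof -
  have "finite V \<longrightarrow> card (clique_sets E s V) \<le> 2 ^ D * card V"
  proof (rule degenerate_induct[OF \<open>finite V\<close> deg])
    show "finite {} \<longrightarrow> card (clique_sets E s {}) \<le> 2 ^ D * card ({} :: 'a set)"
      using \<open>s \<ge> 1\<close> by (auto simp: clique_sets_def)
  next
    fix U v
    assume U: "U \<subseteq> V" "v \<notin> U" and N: "card (nbrs E (insert v U) v) < D"
      and IH: "finite U \<longrightarrow> card (clique_sets E s U) \<le> 2 ^ D * card U"
    have fin: "finite U" using U \<open>finite V\<close> finite_subset by blast
    let ?N = "nbrs E (insert v U) v"
    have fN: "finite ?N" using fin by simp
    have sub: "clique_sets E s (insert v U) \<subseteq> clique_sets E s U \<union> insert v ` Pow ?N"
    proof
      fix B assume B: "B \<in> clique_sets E s (insert v U)"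
      show "B \<in> clique_sets E s U \<union> insert v ` Pow ?N"
      proof (cases "v \<in> B")
        case True
        then have "B = insert v (B - {v})" "B - {v} \<in> Pow ?N"
          using B by (auto simp: clique_sets_def nbrs_def)
        then show ?thesis by blast
      qed (use B in \<open>auto simp: clique_sets_def\<close>)
    qed
    have fc: "finite (clique_sets E s U)"
      using fin by (auto simp: clique_sets_def intro: finite_subset[of _ "Pow U"])
    have "card (clique_sets E s (insert v U)) \<le> card (clique_sets E s U \<union> insert v ` Pow ?N)"
      using sub fc fN by (intro card_mono) auto
    also have "\<dots> \<le> card (clique_sets E s U) + card (insert v ` Pow ?N)"
      by (rule card_Un_le)
    also have "card (insert v ` Pow ?N) \<le> card (Pow ?N)"
      using fN by (intro card_image_le) auto
    also have "card (Pow ?N) \<le> 2 ^ D"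
      using N fN by (simp add: card_Pow)
    finally show "finite (insert v U) \<longrightarrow>
        card (clique_sets E s (insert v U)) \<le> 2 ^ D * card (insert v U)"
      using IH fin U by simp
  qed
  then show ?thesis using \<open>finite V\<close> by blast
qed

text \<open>Edges are counted as ordered pairs, so a new vertex adds its fewer than \<open>D\<close>
  edges twice.\<close>

lemma degenerate_card_arcs:
  assumes "finite V" and "symp E"
    and deg: "\<And>U. U \<subseteq> V \<Longrightarrow> U \<noteq> {} \<Longrightarrow> \<exists>v\<in>U. card (nbrs E U v) < D"
  shows "card (SIGMA x:V. nbrs E V x) \<le> 2 * D * card V"
proof -
  have "finite V \<longrightarrow> card (SIGMA x:V. nbrs E V x) \<le> 2 * D * card V"
  proof (rule degenerate_induct[OF \<open>finite V\<close> deg])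
    fix U v
    assume U: "U \<subseteq> V" "v \<notin> U" and N: "card (nbrs E (insert v U) v) < D"
      and IH: "finite U \<longrightarrow> card (SIGMA x:U. nbrs E U x) \<le> 2 * D * card U"
    have fin: "finite U" using U \<open>finite V\<close> finite_subset by blast
    let ?N = "nbrs E (insert v U) v"
    have fN: "finite ?N" using fin by simp
    have "card (SIGMA x:insert v U. nbrs E (insert v U) x)
          \<le> card (((SIGMA x:U. nbrs E U x) \<union> {v} \<times> ?N) \<union> ?N \<times> {v})"
      using fin fN \<open>symp E\<close> by (intro card_mono) (auto simp: nbrs_def symp_def)
    also have "\<dots> \<le> card ((SIGMA x:U. nbrs E U x) \<union> {v} \<times> ?N) + card (?N \<times> {v})"
      by (rule card_Un_le)
    also have "\<dots> \<le> card (SIGMA x:U. nbrs E U x) + card ({v} \<times> ?N) + card (?N \<times> {v})"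
      using card_Un_le by (simp add: add_mono)
    also have "\<dots> \<le> 2 * D * card U + D + D"
      using IH fin N by (simp add: card_cartesian_product)
    finally show "finite (insert v U) \<longrightarrow>
        card (SIGMA x:insert v U. nbrs E (insert v U) x) \<le> 2 * D * card (insert v U)"
      using fin U by simp
  qed auto
  then show ?thesis using \<open>finite V\<close> by blast
qed

text \<open>Deleting a vertex of degree at most \<open>D\<close> from one side loses at most
  \<open>D\<close> arcs and lowers the right-hand side by exactly \<open>D\<close>, so the
  inequality survives until no such vertex is left. The two sides may overlap or coincide; they are
  treated as separate copies, hence \<open>X'\<close> and \<open>Y'\<close> may differ even if
  \<open>X = Y\<close>.\<close>

lemma dense_pair_min_degree:
  assumes "finite X" "finite Y" "symp E"
    and "card (SIGMA x:X. nbrs E Y x) > D * (card X + card Y)"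
  shows "\<exists>X'\<subseteq>X. \<exists>Y'\<subseteq>Y. X' \<noteq> {} \<and> (\<forall>x\<in>X'. card (nbrs E Y' x) > D) \<and>
           (\<forall>y\<in>Y'. card (nbrs E X' y) > D)"
  using assms
proof (induction "card X + card Y" arbitrary: X Y rule: less_induct)
  case less
  note fin = \<open>finite X\<close> \<open>finite Y\<close>
  consider x where "x \<in> X" "card (nbrs E Y x) \<le> D" | y where "y \<in> Y" "card (nbrs E X y) \<le> D"
    | "\<forall>x\<in>X. card (nbrs E Y x) > D" "\<forall>y\<in>Y. card (nbrs E X y) > D"
    using not_le by blast
  then show ?case
  proof cases
    case 1
    have "card (SIGMA x:X. nbrs E Y x)
          \<le> card ((SIGMA x:X - {x}. nbrs E Y x) \<union> {x} \<times> nbrs E Y x)"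
      using fin by (intro card_mono) auto
    also have "\<dots> \<le> card (SIGMA x:X - {x}. nbrs E Y x) + card ({x} \<times> nbrs E Y x)"
      by (rule card_Un_le)
    also have "\<dots> \<le> card (SIGMA x:X - {x}. nbrs E Y x) + D"
      using 1 by (simp add: card_cartesian_product)
    finally have le: "card (SIGMA x:X. nbrs E Y x) \<le> card (SIGMA x:X - {x}. nbrs E Y x) + D" .
    have cX: "card X = Suc (card (X - {x}))"
      using fin 1 by (metis card_Suc_Diff1)
    have "D * (card (X - {x}) + card Y) < card (SIGMA x:X - {x}. nbrs E Y x)"
      using le less.prems(4) unfolding cX by simp
    then have "\<exists>X'\<subseteq>X - {x}. \<exists>Y'\<subseteq>Y. X' \<noteq> {} \<and> (\<forall>x\<in>X'. card (nbrs E Y' x) > D) \<and>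
           (\<forall>y\<in>Y'. card (nbrs E X' y) > D)"
      using less.prems cX by (intro less.hyps) auto
    then show ?thesis by blast
  next
    case 2
    have "card (SIGMA x:X. nbrs E Y x)
          \<le> card ((SIGMA x:X. nbrs E (Y - {y}) x) \<union> nbrs E X y \<times> {y})"
      using fin \<open>symp E\<close> by (intro card_mono) (auto simp: nbrs_def symp_def)
    also have "\<dots> \<le> card (SIGMA x:X. nbrs E (Y - {y}) x) + card (nbrs E X y \<times> {y})"
      by (rule card_Un_le)
    also have "\<dots> \<le> card (SIGMA x:X. nbrs E (Y - {y}) x) + D"
      using 2 by (simp add: card_cartesian_product)
    finally have le: "card (SIGMA x:X. nbrs E Y x) \<le> card (SIGMA x:X. nbrs E (Y - {y}) x) + D" .
    have cY: "card Y = Suc (card (Y - {y}))"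
      using fin 2 by (metis card_Suc_Diff1)
    have "D * (card X + card (Y - {y})) < card (SIGMA x:X. nbrs E (Y - {y}) x)"
      using le less.prems(4) unfolding cY by simp
    then have "\<exists>X'\<subseteq>X. \<exists>Y'\<subseteq>Y - {y}. X' \<noteq> {} \<and> (\<forall>x\<in>X'. card (nbrs E Y' x) > D) \<and>
           (\<forall>y\<in>Y'. card (nbrs E X' y) > D)"
      using less.prems cY by (intro less.hyps) auto
    then show ?thesis by blast
  next
    case 3
    have "X \<noteq> {}" using less.prems(4) by auto
    then show ?thesis using 3 by blast
  qed
qed

text \<open>The path is chosen greedily: the current endpoint has more than \<open>D\<close>
  neighbours on the other side, while the forbidden set \<open>Z\<close> together with the vertices
  already used has at most \<open>D\<close> elements. In the induction \<open>X\<close> and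
  \<open>Y\<close> change roles and \<open>y\<close> joins \<open>Z\<close>.\<close>

lemma alternating_path:
  assumes "finite X" "finite Y"
    and "\<And>x. x \<in> X \<Longrightarrow> card (nbrs E Y x) > D" "\<And>y. y \<in> Y \<Longrightarrow> card (nbrs E X y) > D"
    and "y \<in> Y" "y \<notin> Z" "finite Z" "card Z + r \<le> D"
  shows "\<exists>xs. length xs = Suc r \<and> hd xs = y \<and> distinct xs \<and> successively E xs \<and>
           set xs \<inter> Z = {} \<and> set xs \<subseteq> X \<union> Y \<and> last xs \<in> (if even r then Y else X)"
  using assms
proof (induction r arbitrary: X Y y Z)
  case 0
  then show ?case by (intro exI[of _ "[y]"]) auto
next
  case (Suc r)
  have cI: "card (insert y Z) = Suc (card Z)" using Suc.prems by simp
  have "card (insert y Z) < card (nbrs E X y)"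
    using cI Suc.prems(4)[OF Suc.prems(5)] Suc.prems(8) by simp
  then have "\<not> nbrs E X y \<subseteq> insert y Z"
    using Suc.prems(7) card_mono[of "insert y Z" "nbrs E X y"] by auto
  then obtain x where x: "x \<in> X" "E y x" "x \<notin> insert y Z" by (auto simp: nbrs_def)
  obtain xs where xs: "length xs = Suc r" "hd xs = x" "distinct xs" "successively E xs"
    "set xs \<inter> insert y Z = {}" "set xs \<subseteq> Y \<union> X" "last xs \<in> (if even r then X else Y)"
    using Suc.IH[of Y X x "insert y Z"] Suc.prems x cI by auto
  then have "xs \<noteq> []" by auto
  with xs x show ?case
    using Suc.prems(5,6) by (intro exI[of _ "y # xs"]) (auto simp: successively_Cons)
qed

text \<open>A subset of the neighbourhood of \<open>v\<close> with all degrees at least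
  \<open>l\<close> would contain a path on \<open>l - 1\<close> vertices, which \<open>v\<close>
  closes to an \<open>l\<close>-cycle. So neighbourhoods are degenerate, and an
  \<open>s\<close>-clique is a vertex together with an \<open>(s - 1)\<close>-clique in its
  neighbourhood.\<close>

lemma card_cliques_cycle_free:
  assumes "finite V" "symp E" "irreflp E" "s \<ge> 2" "l \<ge> 3" "\<not> has_cycle E l"
  shows "card (clique_sets E s V) \<le> 2 ^ l * card (SIGMA x:V. nbrs E V x)"
proof -
  have "card (clique_sets E (s - 1) (nbrs E V v)) \<le> 2 ^ l * card (nbrs E V v)" for v
  proof (rule degenerate_card_cliques)
    fix U assume U: "U \<subseteq> nbrs E V v" "U \<noteq> {}"
    show "\<exists>u\<in>U. card (nbrs E U u) < l"
    proof (rule ccontr)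
      assume neg: "\<not> ?thesis"
      have deg: "card (nbrs E U u) > l - 1" if "u \<in> U" for u
      proof -
        have "l \<le> card (nbrs E U u)" using neg that not_less by blast
        then show ?thesis using \<open>l \<ge> 3\<close> by linarith
      qed
      have fin: "finite U" using finite_subset[OF U(1)] \<open>finite V\<close> by simp
      obtain u where "u \<in> U" using U by blast
      moreover have "l - 2 \<le> l - Suc 0" by simp
      ultimately obtain xs where xs: "length xs = Suc (l - 2)" "distinct xs" "successively E xs"
        "set xs \<subseteq> U \<union> U"
        using alternating_path[OF fin fin deg deg, of u "{}" "l - 2"] by auto
      have ne: "xs \<noteq> []" using xs by auto
      have adj: "E v x" if "x \<in> set xs" for x using that xs U by (auto simp: nbrs_def)
      have "v \<notin> set xs" using adj \<open>irreflp E\<close> by (auto simp: irreflp_def)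
      then have "has_cycle E l"
        unfolding has_cycle_def
        using xs ne adj \<open>symp E\<close> \<open>l \<ge> 3\<close>
        by (intro exI[of _ "v # xs"]) (auto simp: successively_Cons symp_def)
      then show False using assms by blast
    qed
  qed (use assms in auto)
  note nb = this
  have fc: "finite (clique_sets E r (nbrs E V v))" for r v
    using \<open>finite V\<close> by (auto simp: clique_sets_def intro!: finite_subset[of _ "Pow (nbrs E V v)"])
  have sub: "clique_sets E s V \<subseteq> (\<Union>v\<in>V. insert v ` clique_sets E (s - 1) (nbrs E V v))"
  proof
    fix B assume B: "B \<in> clique_sets E s V"
    then have "B \<noteq> {}" using \<open>s \<ge> 2\<close> by (auto simp: clique_sets_def)
    then obtain v where v: "v \<in> B" by blast
    then have "B - {v} \<in> clique_sets E (s - 1) (nbrs E V v)" "B = insert v (B - {v})" "v \<in> V"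
      using B by (auto simp: clique_sets_def nbrs_def)
    then show "B \<in> (\<Union>v\<in>V. insert v ` clique_sets E (s - 1) (nbrs E V v))" by blast
  qed
  have "card (clique_sets E s V) \<le> card (\<Union>v\<in>V. insert v ` clique_sets E (s - 1) (nbrs E V v))"
    using sub fc \<open>finite V\<close> by (intro card_mono) auto
  also have "\<dots> \<le> (\<Sum>v\<in>V. card (insert v ` clique_sets E (s - 1) (nbrs E V v)))"
    by (rule card_UN_le[OF \<open>finite V\<close>])
  also have "\<dots> \<le> (\<Sum>v\<in>V. 2 ^ l * card (nbrs E V v))"
    by (intro sum_mono order_trans[OF card_image_le nb] fc)
  also have "\<dots> = 2 ^ l * card (SIGMA x:V. nbrs E V x)"
    using \<open>finite V\<close> by (simp add: sum_distrib_left)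
  finally show ?thesis .
qed

section \<open>Even cycles\<close>

fun bfs_ball :: "('a \<Rightarrow> 'a \<Rightarrow> bool) \<Rightarrow> 'a set \<Rightarrow> 'a \<Rightarrow> nat \<Rightarrow> 'a set" where
  "bfs_ball E U v 0 = {v}"
| "bfs_ball E U v (Suc i) = bfs_ball E U v i \<union> {u \<in> U. \<exists>w\<in>bfs_ball E U v i. E w u}"

definition level :: "('a \<Rightarrow> 'a \<Rightarrow> bool) \<Rightarrow> 'a set \<Rightarrow> 'a \<Rightarrow> nat \<Rightarrow> 'a set" where
  "level E U v i = bfs_ball E U v i - (\<Union>j<i. bfs_ball E U v j)"

lemma bfs_ball_subset: "v \<in> U \<Longrightarrow> bfs_ball E U v i \<subseteq> U"
  by (induction i) auto

lemma level_subset: "v \<in> U \<Longrightarrow> level E U v i \<subseteq> U"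
  using bfs_ball_subset[of v U E i] by (auto simp: level_def)

lemma level_0 [simp]: "level E U v 0 = {v}"
  by (simp add: level_def)

lemma level_unique:
  assumes "u \<in> level E U v i" "u \<in> level E U v j"
  shows "i = j"
  using assms unfolding level_def
  by (metis DiffD1 DiffD2 UN_iff lessThan_iff linorder_neqE_nat)

lemma level_parent:
  assumes "u \<in> level E U v (Suc i)"
  shows "\<exists>w\<in>level E U v i. E w u"
proof -
  have u: "u \<notin> bfs_ball E U v j" if "j \<le> i" for j
    using assms that by (auto simp: level_def)
  then obtain w where w: "u \<in> U" "w \<in> bfs_ball E U v i" "E w u"
    using assms by (auto simp: level_def)
  have "w \<notin> bfs_ball E U v j" if "j < i" for j
    using u[of "Suc j"] that w by auto
  then show ?thesis using w by (auto simp: level_def)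
qed

text \<open>The level of \<open>u\<close> is the least index of a ball containing it. The ball
  following that of \<open>w\<close> contains \<open>u\<close>, and by symmetry the ball following
  that of \<open>u\<close> contains \<open>w\<close>, so an edge never skips a level.\<close>

lemma level_step:
  assumes "symp E" "v \<in> U" "w \<in> level E U v i" "u \<in> U" "E w u"
  shows "\<exists>j. u \<in> level E U v j \<and> j \<le> Suc i \<and> i \<le> Suc j"
proof -
  have w: "w \<in> bfs_ball E U v i" "w \<in> U" "\<And>j. j < i \<Longrightarrow> w \<notin> bfs_ball E U v j"
    using assms level_subset[of v U E i] by (auto simp: level_def)
  have u: "u \<in> bfs_ball E U v (Suc i)" using w assms by auto
  define j where "j = (LEAST j. u \<in> bfs_ball E U v j)"
  have j: "u \<in> bfs_ball E U v j" "j \<le> Suc i"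
    unfolding j_def
    using LeastI[of "\<lambda>j. u \<in> bfs_ball E U v j", OF u] Least_le[of "\<lambda>j. u \<in> bfs_ball E U v j", OF u]
    by blast+
  have "u \<in> level E U v j"
    using j not_less_Least[of _ "\<lambda>j. u \<in> bfs_ball E U v j"] by (auto simp: level_def j_def)
  moreover have "w \<in> bfs_ball E U v (Suc j)"
    using w j assms by (auto simp: symp_def)
  then have "i \<le> Suc j" using w(3) not_le by blast
  ultimately show ?thesis using j by blast
qed

text \<open>Two neighbours \<open>x\<close>, \<open>x'\<close> of a vertex \<open>y\<close> of \<open>Y\<close> are joined to the same vertex \<open>w\<close> by two
  paths through \<open>y\<close> of the same length. If \<open>x\<close>, \<open>x'\<close> are chosen with their branches meeting as
  close to the root as possible, say \<open>h\<close> levels up, then \<open>w\<close> also has this \<open>h\<close>-th ancestor, but one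
  of \<open>x\<close>, \<open>x'\<close> reaches it on a branch disjoint from that of \<open>w\<close>.\<close>

lemma level_cycle:
  assumes "symp E" "irreflp E" "finite U" "v \<in> U" "i < m"
    and X: "X \<subseteq> level E U v i" "X \<noteq> {}"
    and Y: "Y \<subseteq> U" "\<And>j. j < i \<Longrightarrow> Y \<inter> level E U v j = {}"
    and degX: "\<And>x. x \<in> X \<Longrightarrow> card (nbrs E Y x) > 2 * m"
    and degY: "\<And>y. y \<in> Y \<Longrightarrow> card (nbrs E X y) > 2 * m"
  shows "has_cycle E (2 * m)"
proof -
  let ?L = "level E U v"
  have sym: "E a b \<Longrightarrow> E b a" for a b using \<open>symp E\<close> by (simp add: symp_def)
  have fin: "finite X" "finite Y"
    using X Y level_subset[OF \<open>v \<in> U\<close>] \<open>finite U\<close> by (meson finite_subset)+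
  \<comment> \<open>A parent in the search tree, chosen once for all levels: \<open>j\<close> is
    quantified inside the choice, and levels are disjoint. Then \<open>(p ^^ h) w\<close> is the
    \<open>h\<close>-th ancestor of \<open>w\<close>.\<close>
  define p where "p w = (SOME u. \<exists>j. w \<in> ?L (Suc j) \<and> u \<in> ?L j \<and> E w u)" for w
  have p: "p w \<in> ?L j \<and> E w (p w)" if w: "w \<in> ?L (Suc j)" for w j
  proof -
    have "\<exists>u. \<exists>j. w \<in> ?L (Suc j) \<and> u \<in> ?L j \<and> E w u"
      using level_parent[OF w] w sym by blast
    then have "\<exists>j. w \<in> ?L (Suc j) \<and> p w \<in> ?L j \<and> E w (p w)"
      unfolding p_def by (rule someI_ex)
    then show ?thesis using level_unique[OF w] by blast
  qed
  have pl: "(p ^^ h) w \<in> ?L (i - h)" if "w \<in> ?L i" "h \<le> i" for w h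
    using that
  proof (induction h)
    case (Suc h)
    then have "(p ^^ h) w \<in> ?L (Suc (i - Suc h))" by (simp add: Suc_diff_Suc)
    then show ?case using p by simp
  qed auto
  have pE: "E ((p ^^ h) w) ((p ^^ Suc h) w)" if "w \<in> ?L i" "h < i" for w h
  proof -
    have "(p ^^ h) w \<in> ?L (Suc (i - Suc h))"
      using pl[of w h] that by (simp add: Suc_diff_Suc)
    then show ?thesis using p by simp
  qed
  \<comment> \<open>\<open>Q h\<close> says that all neighbours in \<open>X\<close> of a vertex of
    \<open>Y\<close> share their \<open>h\<close>-th ancestor. It holds at the root,
    \<open>h = i\<close>, and fails for \<open>h = 0\<close> because a vertex of \<open>Y\<close>
    has several neighbours in \<open>X\<close>.\<close>
  define Q where
    "Q h \<longleftrightarrow> (\<forall>x\<in>X. \<forall>x'\<in>X. \<forall>y\<in>Y. E y x \<longrightarrow> E y x' \<longrightarrow> (p ^^ h) x = (p ^^ h) x')" for h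
  have "(p ^^ i) x = v" if "x \<in> X" for x
    using pl[of x i] that X by auto
  then have Qi: "Q i" by (simp add: Q_def)
  have nQ0: "\<not> Q 0"
  proof -
    obtain x where x: "x \<in> X" using X by blast
    then have "nbrs E Y x \<noteq> {}" using degX by fastforce
    then obtain y where y: "y \<in> Y" "E x y" by (auto simp: nbrs_def)
    have "card {x} < card (nbrs E X y)" using degY[OF y(1)] \<open>i < m\<close> by simp
    then have "\<not> nbrs E X y \<subseteq> {x}" using card_mono[of "{x}" "nbrs E X y"] by auto
    then obtain x' where "x' \<in> X" "E y x'" "x' \<noteq> x" by (auto simp: nbrs_def)
    then show ?thesis using x y sym unfolding Q_def funpow_0 by metis
  qed
  define h where "h = (LEAST h. Q h)"
  have h: "Q h" "h \<le> i" unfolding h_def using Qi by (auto intro: LeastI Least_le)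
  then have "h \<noteq> 0" using nQ0 by metis
  then obtain g where g: "h = Suc g" using not0_implies_Suc by blast
  have "\<not> Q g" using not_less_Least[of g Q] g by (simp add: h_def)
  then obtain x x' y where xy: "x \<in> X" "x' \<in> X" "y \<in> Y" "E y x" "E y x'"
    "(p ^^ g) x \<noteq> (p ^^ g) x'"
    unfolding Q_def by blast
  \<comment> \<open>By \<open>Q h\<close>, the sets \<open>X'\<close> and \<open>Y'\<close> contain
    all neighbours that their elements have in \<open>X\<close> and \<open>Y\<close>, so the degree
    bounds carry over to them.\<close>
  define X' where "X' = {u \<in> X. (p ^^ h) u = (p ^^ h) x}"
  define Y' where "Y' = {y \<in> Y. \<exists>u\<in>X'. E y u}"
  have "x \<in> X'" using xy by (simp add: X'_def)
  have "nbrs E Y' u = nbrs E Y u" if "u \<in> X'" for u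
    using that sym by (auto simp: nbrs_def Y'_def)
  then have dX': "card (nbrs E Y' u) > 2 * m" if "u \<in> X'" for u
    using that degX by (simp add: X'_def)
  have "nbrs E X' z = nbrs E X z" if "z \<in> Y'" for z
  proof -
    obtain u where u: "u \<in> X'" "E z u" "z \<in> Y" using \<open>z \<in> Y'\<close> by (auto simp: Y'_def)
    have "(p ^^ h) u' = (p ^^ h) x" if "u' \<in> X" "E z u'" for u'
      using h(1) u that unfolding Q_def X'_def by (metis (mono_tags, lifting) mem_Collect_eq)
    then show ?thesis by (auto simp: nbrs_def X'_def)
  qed
  then have dY': "card (nbrs E X' z) > 2 * m" if "z \<in> Y'" for z
    using that degY by (simp add: Y'_def)
  have "y \<in> Y'" using xy \<open>x \<in> X'\<close> by (auto simp: Y'_def)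
  have "y \<notin> {x, x'}" using xy \<open>irreflp E\<close> by (auto simp: irreflp_def)
  moreover have "card {x, x'} + (2 * (m - h) - 1) \<le> 2 * m"
    using h \<open>i < m\<close> g by (cases "x = x'") auto
  moreover have "finite X'" "finite Y'" using fin by (auto simp: X'_def Y'_def)
  \<comment> \<open>The path starts at \<open>y\<close>, avoids \<open>x\<close> and
    \<open>x'\<close>, and has an odd number of edges, hence ends in \<open>X'\<close>. Its
    \<open>2 * (m - h)\<close> vertices leave room for \<open>h\<close> vertices on each of two tree
    branches.\<close>
  ultimately obtain zs where zs: "length zs = Suc (2 * (m - h) - 1)" "hd zs = y" "distinct zs"
    "successively E zs" "set zs \<inter> {x, x'} = {}" "set zs \<subseteq> X' \<union> Y'"
    "last zs \<in> (if even (2 * (m - h) - 1) then Y' else X')"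
    using alternating_path[of X' Y' "2 * m" E y "{x, x'}" "2 * (m - h) - 1"] dX' dY' \<open>y \<in> Y'\<close>
    by auto
  have hm: "h < m" using h \<open>i < m\<close> by simp
  have len: "length zs = 2 * (m - h)" "zs \<noteq> []" using zs(1) hm by auto
  define w where "w = last zs"
  have "odd (2 * (m - h) - 1)" using hm by simp
  then have w: "w \<in> X" "(p ^^ h) w = (p ^^ h) x"
    using zs(7) by (auto simp: w_def X'_def)
  have "(p ^^ h) x' = (p ^^ h) x" using h(1) xy unfolding Q_def by metis
  \<comment> \<open>The \<open>g\<close>-th ancestors of \<open>x\<close> and \<open>x'\<close>
    differ, so at least one of them differs from that of \<open>w\<close>; \<open>a\<close> is the
    corresponding vertex.\<close>
  then obtain a where a: "a \<in> X" "E y a" "a \<notin> set zs" "(p ^^ h) w = (p ^^ h) a"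
    "(p ^^ g) w \<noteq> (p ^^ g) a"
    using w(2) xy zs(5) by (metis disjoint_insert(1))
  have lev: "w \<in> ?L i" "a \<in> ?L i" using w a X by auto
  \<comment> \<open>A common vertex of the two branches would lie at the same height on both, and
    then the ancestors would agree from there on, in particular at height \<open>g\<close>.\<close>
  have sep: "(p ^^ j) w \<noteq> (p ^^ k) a" if "j \<le> h" "k < h" for j k
  proof
    assume eq: "(p ^^ j) w = (p ^^ k) a"
    have "(p ^^ j) w \<in> ?L (i - j)" "(p ^^ k) a \<in> ?L (i - k)"
      using pl lev that h by auto
    then have "i - j = i - k" using eq level_unique by metis
    then have jk: "j = k" using that h by simp
    have "(p ^^ (g - j + j)) w = (p ^^ (g - j + j)) a"
      using eq by (simp only: jk funpow_add o_apply)
    then show False using a(5) that jk g by simp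
  qed
  have inj: "inj_on (\<lambda>j. (p ^^ j) u) {..h}" if "u \<in> ?L i" for u
  proof (rule inj_onI)
    fix j k assume jk: "j \<in> {..h}" "k \<in> {..h}" and eq: "(p ^^ j) u = (p ^^ k) u"
    have "(p ^^ j) u \<in> ?L (i - j)" "(p ^^ k) u \<in> ?L (i - k)"
      using pl that jk h by auto
    then have "i - j = i - k" using eq level_unique by metis
    then show "j = k" using jk h by simp
  qed
  \<comment> \<open>Proper ancestors lie in levels below \<open>i\<close>, which neither
    \<open>X\<close> nor \<open>Y\<close> meets.\<close>
  have out: "(p ^^ j) u \<notin> set zs" if "u \<in> ?L i" "1 \<le> j" "j \<le> h" for u j
  proof
    assume "(p ^^ j) u \<in> set zs"
    then have "(p ^^ j) u \<in> X \<union> Y" using zs(6) by (auto simp: X'_def Y'_def)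
    moreover have "(p ^^ j) u \<in> ?L (i - j)" using pl that h by simp
    moreover have "i - j < i" using that h by simp
    ultimately show False using Y(2)[of "i - j"] X(1) level_unique[of _ E U v i "i - j"] by auto
  qed
  \<comment> \<open>The cycle runs along \<open>zs\<close> from \<open>y\<close> to
    \<open>w\<close>, up to the common ancestor through \<open>ws\<close>, and down through the
    reverse of \<open>as\<close> to \<open>a\<close>, which is adjacent to \<open>y\<close>. The
    common ancestor is put in \<open>ws\<close> only.\<close>
  define ws where "ws = map (\<lambda>j. (p ^^ j) w) [1..<Suc h]"
  define as where "as = map (\<lambda>j. (p ^^ j) a) [0..<h]"
  have ne: "ws \<noteq> []" "as \<noteq> []" using g by (auto simp: ws_def as_def)
  have hds: "hd ws = p w" "last ws = (p ^^ h) w" "hd as = a" "last as = (p ^^ g) a"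
    using g by (auto simp: ws_def as_def hd_map hd_upt last_map simp del: upt_Suc)
  have "distinct ws" unfolding ws_def
    by (auto simp: distinct_map simp del: upt_Suc intro: inj_on_subset[OF inj[OF lev(1)]])
  moreover have "distinct as" unfolding as_def
    by (auto simp: distinct_map simp del: upt_Suc intro: inj_on_subset[OF inj[OF lev(2)]])
  moreover have "set ws \<inter> set as = {}"
    using sep by (auto simp: ws_def as_def simp del: upt_Suc)
  moreover have "set zs \<inter> set ws = {}"
    using out[OF lev(1)] by (auto simp: ws_def simp del: upt_Suc)
  moreover have "(p ^^ j) a \<notin> set zs" if "j < h" for j
    using out[OF lev(2), of j] a(3) that by (cases "j = 0") auto
  then have "set zs \<inter> set as = {}" by (auto simp: as_def)
  ultimately have dist: "distinct (zs @ ws @ rev as)" using zs(3) by auto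
  have "E (ws ! j) (ws ! Suc j)" if "Suc j < length ws" for j
    using pE[OF lev(1), of "Suc j"] h that by (simp add: ws_def del: upt_Suc)
  moreover have "E (as ! Suc j) (as ! j)" if "Suc j < length as" for j
    using pE[OF lev(2), of j] h that sym by (simp add: as_def)
  ultimately have "successively E ws" "successively (\<lambda>x y. E y x) as"
    by (auto simp: successively_conv_nth)
  then have sE: "successively E ws" "successively E (rev as)"
    by simp_all
  have "E w (p w)" using pE[OF lev(1), of 0] g h by simp
  moreover have "E ((p ^^ h) w) ((p ^^ g) a)" using pE[OF lev(2), of g] g h sym a(4) by simp
  ultimately have "successively E (zs @ ws @ rev as)"
    using sE zs(4) ne len hds by (simp add: successively_append_iff hd_rev w_def)
  moreover have "length (zs @ ws @ rev as) = 2 * m"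
  proof -
    have "length ws = h" "length as = h" using g by (simp_all add: ws_def as_def)
    then show ?thesis using len hm by simp
  qed
  moreover have "E (last (zs @ ws @ rev as)) (hd (zs @ ws @ rev as))"
    using len ne hds zs(2) a(2) sym by (simp add: last_rev)
  ultimately show ?thesis using dist unfolding has_cycle_def by blast
qed

text \<open>More arcs would yield a subpair in which all degrees exceed \<open>2 * m\<close>, and
  \<open>level_cycle\<close> finds a \<open>2 * m\<close>-cycle there. The second bound counts the
  same arcs backwards.\<close>

lemma arcs_level_bound:
  assumes "symp E" "irreflp E" "finite U" "v \<in> U" "i < m" "\<not> has_cycle E (2 * m)" "j = i \<or> j = Suc i"
  defines "L \<equiv> level E U v"
  shows "card (SIGMA x:L i. nbrs E (L j) x) \<le> 2 * m * (card (L i) + card (L j))"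
    and "card (SIGMA x:L j. nbrs E (L i) x) \<le> 2 * m * (card (L i) + card (L j))"
proof -
  have LU: "L r \<subseteq> U" for r using level_subset \<open>v \<in> U\<close> by (simp add: L_def)
  have fin: "finite (L r)" for r using LU \<open>finite U\<close> finite_subset by blast
  show *: "card (SIGMA x:L i. nbrs E (L j) x) \<le> 2 * m * (card (L i) + card (L j))"
  proof (rule ccontr)
    assume "\<not> ?thesis"
    then obtain X Y where XY: "X \<subseteq> L i" "Y \<subseteq> L j" "X \<noteq> {}"
      "\<forall>x\<in>X. card (nbrs E Y x) > 2 * m" "\<forall>y\<in>Y. card (nbrs E X y) > 2 * m"
      using dense_pair_min_degree[of "L i" "L j" E "2 * m"] fin \<open>symp E\<close> by (auto simp: not_le)
    have "Y \<inter> level E U v r = {}" if "r < i" for r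
    proof -
      have "r \<noteq> j" using that assms(7) by auto
      then show ?thesis using XY(2) level_unique[of _ E U v r j] by (auto simp: L_def)
    qed
    then have "has_cycle E (2 * m)"
      using assms XY LU[of j] by (intro level_cycle[of E U v i m X Y]) (auto simp: L_def)
    then show False using assms by blast
  qed
  have "card (SIGMA x:L j. nbrs E (L i) x) = card (prod.swap ` (SIGMA x:L i. nbrs E (L j) x))"
    using \<open>symp E\<close> by (intro arg_cong[where f = card]) (auto simp: nbrs_def symp_def)
  also have "\<dots> = card (SIGMA x:L i. nbrs E (L j) x)"
    by (rule card_image) auto
  finally show "card (SIGMA x:L j. nbrs E (L i) x) \<le> 2 * m * (card (L i) + card (L j))"
    using * by simp
qed

text \<open>All arcs leaving a level end in the same or an adjacent level. The degrees force many
  such arcs, and few of them can stay in the level or go back, so the next level must be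
  large.\<close>

lemma level_growth:
  assumes "symp E" "irreflp E" "finite U" "v \<in> U" "\<not> has_cycle E (2 * m)" "a \<ge> 1"
    and deg: "\<And>u. u \<in> U \<Longrightarrow> card (nbrs E U u) \<ge> 2 * m * (5 + a)"
  shows "i < m \<Longrightarrow> a * card (level E U v i) \<le> card (level E U v (Suc i))"
proof (induction i)
  define L where "L = level E U v"
  define c where "c r = card (L r)" for r
  have LU: "L r \<subseteq> U" for r using level_subset \<open>v \<in> U\<close> by (simp add: L_def)
  have fin: "finite (L r)" for r using LU \<open>finite U\<close> finite_subset by blast
  define s where "s r q = card (SIGMA x:L r. nbrs E (L q) x)" for r q
  have s: "s r q \<le> 2 * m * (c r + c q)" "s q r \<le> 2 * m * (c r + c q)"
    if "r < m" "q = r \<or> q = Suc r" for r q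
    using arcs_level_bound[OF assms(1-4) that(1) assms(5) that(2)]
    by (auto simp: s_def c_def L_def)
  have lower: "2 * m * (5 + a) * c r \<le> card (SIGMA x:L r. nbrs E U x)" for r
  proof -
    have "2 * m * (5 + a) * c r = (\<Sum>x\<in>L r. 2 * m * (5 + a))" by (simp add: c_def)
    also have "\<dots> \<le> (\<Sum>x\<in>L r. card (nbrs E U x))"
      using deg LU by (intro sum_mono) auto
    finally show ?thesis using fin \<open>finite U\<close> by simp
  qed
  {
    case 0
    have "(SIGMA x:L 0. nbrs E U x) \<subseteq> (SIGMA x:L 0. nbrs E (L 0) x) \<union> (SIGMA x:L 0. nbrs E (L 1) x)"
    proof clarify
      fix x u assume xu: "x \<in> L 0" "u \<in> nbrs E U x" "u \<notin> nbrs E (L 1) x"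
      obtain j where "u \<in> L j" "j \<le> 1"
        using level_step[of E v U x 0 u] xu \<open>symp E\<close> \<open>v \<in> U\<close> by (auto simp: L_def nbrs_def)
      then show "u \<in> nbrs E (L 0) x"
        using xu le_Suc_eq[of j 0] by (auto simp: nbrs_def)
    qed
    then have "card (SIGMA x:L 0. nbrs E U x) \<le>
        card ((SIGMA x:L 0. nbrs E (L 0) x) \<union> (SIGMA x:L 0. nbrs E (L 1) x))"
      using fin by (intro card_mono) auto
    also have "\<dots> \<le> s 0 0 + s 0 1" unfolding s_def by (rule card_Un_le)
    also have "\<dots> \<le> 2 * m * (c 0 + c 0) + 2 * m * (c 0 + c 1)"
      using s[of 0 0] s[of 0 1] 0 by (intro add_mono) auto
    finally have "2 * m * (5 + a) * c 0 \<le> 2 * m * (3 * c 0 + c 1)"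
      using lower[of 0] by (simp add: algebra_simps)
    then have "(5 + a) * c 0 \<le> 3 * c 0 + c 1"
      using 0 mult_le_cancel1[of "2 * m"] by (simp only: mult.assoc[of "2 * m"])
    then show ?case by (simp add: c_def L_def algebra_simps)
  next
    case (Suc i)
    have "(SIGMA x:L (Suc i). nbrs E U x) \<subseteq> ((SIGMA x:L (Suc i). nbrs E (L i) x) \<union>
        (SIGMA x:L (Suc i). nbrs E (L (Suc i)) x)) \<union> (SIGMA x:L (Suc i). nbrs E (L (Suc (Suc i))) x)"
    proof clarify
      fix x u assume xu: "x \<in> L (Suc i)" "u \<in> nbrs E U x" "u \<notin> nbrs E (L (Suc (Suc i))) x"
        "u \<notin> nbrs E (L (Suc i)) x"
      obtain j where "u \<in> L j" "j \<le> Suc (Suc i)" "i \<le> j"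
        using level_step[of E v U x "Suc i" u] xu \<open>symp E\<close> \<open>v \<in> U\<close> by (auto simp: L_def nbrs_def)
      then show "u \<in> nbrs E (L i) x"
        using xu by (auto simp: nbrs_def le_Suc_eq)
    qed
    then have "card (SIGMA x:L (Suc i). nbrs E U x) \<le>
        card (((SIGMA x:L (Suc i). nbrs E (L i) x) \<union>
        (SIGMA x:L (Suc i). nbrs E (L (Suc i)) x)) \<union> (SIGMA x:L (Suc i). nbrs E (L (Suc (Suc i))) x))"
      using fin by (intro card_mono) auto
    also have "\<dots> \<le> card ((SIGMA x:L (Suc i). nbrs E (L i) x) \<union>
        (SIGMA x:L (Suc i). nbrs E (L (Suc i)) x)) + s (Suc i) (Suc (Suc i))"
      unfolding s_def by (rule card_Un_le)
    also have "\<dots> \<le> s (Suc i) i + s (Suc i) (Suc i) + s (Suc i) (Suc (Suc i))"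
      unfolding s_def by (intro add_right_mono card_Un_le)
    also have "\<dots> \<le> 2 * m * (c i + c (Suc i)) + 2 * m * (c (Suc i) + c (Suc i))
        + 2 * m * (c (Suc i) + c (Suc (Suc i)))"
      using s[of i "Suc i"] s[of "Suc i" "Suc i"] s[of "Suc i" "Suc (Suc i)"] Suc.prems
      by (intro add_mono) auto
    \<comment> \<open>After division by \<open>2 * m\<close>, the induction hypothesis and
      \<open>a \<ge> 1\<close> give \<open>c i \<le> c (Suc i)\<close>, so the first two terms on
      the right are at most \<open>5 * c (Suc i)\<close>. This is the 5 in the degree bound.\<close>
    finally have "2 * m * (5 + a) * c (Suc i) \<le> 2 * m * (c i + 4 * c (Suc i) + c (Suc (Suc i)))"
      using lower[of "Suc i"] by (simp add: algebra_simps)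
    then have "(5 + a) * c (Suc i) \<le> c i + 4 * c (Suc i) + c (Suc (Suc i))"
      using Suc.prems mult_le_cancel1[of "2 * m"] by (simp only: mult.assoc[of "2 * m"])
    moreover have "1 * c i \<le> a * c i" using \<open>a \<ge> 1\<close> by (rule mult_le_mono1)
    then have "c i \<le> c (Suc i)"
      using Suc.IH Suc.prems unfolding c_def L_def by linarith
    ultimately show ?case by (simp add: c_def L_def algebra_simps)
  }
qed

text \<open>In a subgraph with all degrees at least \<open>2 * m * (5 + a)\<close> the
  \<open>m\<close>-th level would have at least \<open>a ^ m\<close> vertices, more than there are.
  So the graph is degenerate. Taking \<open>a\<close> just above the \<open>m\<close>-th root of
  \<open>card V\<close> gives the Bondy-Simonovits bound.\<close>

theorem even_cycle_free_card_arcs: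
  assumes "finite V" "symp E" "irreflp E" "\<not> has_cycle E (2 * m)" "a \<ge> 1" "a ^ m > card V"
  shows "card (SIGMA x:V. nbrs E V x) \<le> 4 * m * (5 + a) * card V"
proof -
  have "\<exists>u\<in>U. card (nbrs E U u) < 2 * m * (5 + a)" if U: "U \<subseteq> V" "U \<noteq> {}" for U
  proof (rule ccontr)
    assume "\<not> ?thesis"
    then have deg: "card (nbrs E U u) \<ge> 2 * m * (5 + a)" if "u \<in> U" for u
      using that not_less by blast
    obtain v where v: "v \<in> U" using U by blast
    have fin: "finite U" using U \<open>finite V\<close> finite_subset by blast
    have "a ^ i \<le> card (level E U v i)" if "i \<le> m" for i
      using that
    proof (induction i)
      case (Suc i)
      have "a ^ Suc i \<le> a * card (level E U v i)" using Suc by simp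
      also have "\<dots> \<le> card (level E U v (Suc i))"
        using Suc.prems by (intro level_growth[OF assms(2,3) fin v assms(4,5) deg]) auto
      finally show ?case .
    qed simp
    then have "a ^ m \<le> card (level E U v m)" by simp
    also have "\<dots> \<le> card U" using level_subset[OF v] fin by (rule card_mono[rotated])
    also have "\<dots> \<le> card V" using U \<open>finite V\<close> by (intro card_mono)
    finally show False using assms(6) by simp
  qed
  then have "card (SIGMA x:V. nbrs E V x) \<le> 2 * (2 * m * (5 + a)) * card V"
    using assms by (intro degenerate_card_arcs) auto
  then show ?thesis by simp
qed

section \<open>Cliques in hypergraphs without suspended cycles\<close>

definition link :: "'a set set \<Rightarrow> 'a set \<Rightarrow> 'a \<Rightarrow> 'a \<Rightarrow> bool" where
  "link Es S a b \<longleftrightarrow> a \<noteq> b \<and> a \<notin> S \<and> b \<notin> S \<and> insert a (insert b S) \<in> Es"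

text \<open>An embedding rather than a copy: \<open>S\<close> is the image of the added set and
  \<open>c\<close> lists the cycle. This keeps tagged vertices and isomorphisms out of the later
  arguments.\<close>

definition suspended_cycle :: "nat \<Rightarrow> nat \<Rightarrow> 'a set set \<Rightarrow> 'a set \<Rightarrow> (nat \<Rightarrow> 'a) \<Rightarrow> bool" where
  "suspended_cycle k l Es S c \<longleftrightarrow>
     finite S \<and> card S = k - 2 \<and> inj_on c {..<l} \<and> c ` {..<l} \<inter> S = {} \<and>
     (\<forall>i<l. insert (c i) (insert (c (Suc i mod l)) S) \<in> Es)"

lemma symp_link: "symp (link Es S)"
  by (auto simp: symp_def link_def insert_commute)

lemma irreflp_link: "irreflp (link Es S)"
  by (auto simp: irreflp_def link_def)

lemma has_cycle_link:
  assumes "has_cycle (link Es S) l" "l \<ge> 1" "finite S" "card S = k - 2"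
  shows "\<exists>c. suspended_cycle k l Es S c"
proof -
  obtain xs where xs: "length xs = l" "distinct xs" "successively (link Es S) xs"
    "link Es S (last xs) (hd xs)"
    using assms(1) by (auto simp: has_cycle_def)
  have "xs \<noteq> []" using xs assms by auto
  have adj: "link Es S (xs ! i) (xs ! (Suc i mod l))" if "i < l" for i
  proof (cases "Suc i = l")
    case True
    then show ?thesis
      using xs \<open>xs \<noteq> []\<close> by (auto simp: last_conv_nth hd_conv_nth)
  next
    case False
    then show ?thesis using xs that by (auto simp: successively_conv_nth)
  qed
  have "inj_on ((!) xs) {..<l}"
    using xs by (auto simp: inj_on_def nth_eq_iff_index_eq)
  then have "suspended_cycle k l Es S ((!) xs)"
    using adj assms by (auto simp: suspended_cycle_def link_def)
  then show ?thesis by blast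
qed

text \<open>An isomorphism onto a copy splits along the tags into the image \<open>S\<close> of the
  left part and the map \<open>c\<close> on the right part. Conversely \<open>c\<close> is combined
  with an enumeration of \<open>S\<close>; the resulting vertices belong to \<open>G\<close> because
  each of them lies in an edge.\<close>

lemma free_of_suspension_iff:
  assumes "uniform_hypergraph k G" "l \<ge> 1"
  shows "free_of (suspension k (cycle_graph l)) G \<longleftrightarrow>
           (\<nexists>S c. suspended_cycle k l (edges G) S c)"
proof -
  let ?H = "suspension k (cycle_graph l)"
  have vH: "verts ?H = Inl ` {..<k - 2} \<union> Inr ` {..<l}"
    by (simp add: suspension_def cycle_graph_def)
  have eH: "edges ?H = (\<lambda>i. Inl ` {..<k - 2} \<union> Inr ` {i, Suc i mod l}) ` {..<l}"
    unfolding suspension_def cycle_graph_def hypergraph.sel Suc_eq_plus1 by blast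
  have "\<exists>S c. suspended_cycle k l (edges G) S c" if nf: "\<not> free_of ?H G"
  proof -
    obtain G' where "G' \<in> copies ?H G" using nf by (auto simp: free_of_def)
    then have "edges G' \<subseteq> edges G" "isomorphic ?H G'"
      by (simp_all add: copies_def subhypergraph_def)
    then obtain f where G': "edges G' \<subseteq> edges G" "bij_betw f (verts ?H) (verts G')"
      "edges G' = (\<lambda>e. f ` e) ` edges ?H"
      unfolding isomorphic_def by blast
    have inj: "inj_on f (Inl ` {..<k - 2} \<union> Inr ` {..<l})"
      using G'(2) unfolding bij_betw_def vH by (rule conjunct1)
    let ?S = "f ` Inl ` {..<k - 2}" and ?c = "\<lambda>i. f (Inr i)"
    have "card ?S = k - 2"
      using inj by (simp add: card_image inj_on_Un)
    moreover have "inj_on ?c {..<l}"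
      by (rule inj_onI) (use inj_onD[OF inj] in blast)
    moreover have "?c ` {..<l} \<inter> ?S = {}"
      using inj_onD[OF inj] by blast
    moreover have "insert (?c i) (insert (?c (Suc i mod l)) ?S) \<in> edges G" if "i < l" for i
    proof -
      have "f ` (Inl ` {..<k - 2} \<union> Inr ` {i, Suc i mod l}) \<in> edges G"
        using G'(1,3) eH that by blast
      then show ?thesis by (simp add: image_Un)
    qed
    ultimately have "suspended_cycle k l (edges G) ?S ?c"
      by (simp add: suspended_cycle_def)
    then show ?thesis by blast
  qed
  moreover have "\<not> free_of ?H G" if sc: "suspended_cycle k l (edges G) S c" for S c
  proof -
    have S: "finite S" "card S = k - 2" "inj_on c {..<l}" "c ` {..<l} \<inter> S = {}"
      and e: "\<And>i. i < l \<Longrightarrow> insert (c i) (insert (c (Suc i mod l)) S) \<in> edges G"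
      using sc by (auto simp: suspended_cycle_def)
    obtain g where g: "bij_betw g {..<k - 2} S"
      using ex_bij_betw_nat_finite[OF S(1)] S(2) by (auto simp: atLeast0LessThan)
    let ?f = "case_sum g c"
    let ?G' = "Hypergraph (?f ` verts ?H) ((\<lambda>e. ?f ` e) ` edges ?H)"
    have gS: "g ` {..<k - 2} = S" "inj_on g {..<k - 2}" using g by (auto simp: bij_betw_def)
    have fS: "?f ` Inl ` {..<k - 2} = S" using gS by (simp add: image_image)
    have fc: "?f ` Inr ` A = c ` A" for A by (simp add: image_image)
    have "inj_on ?f (verts ?H)"
      unfolding vH inj_on_Un
    proof (intro conjI)
      show "inj_on ?f (Inl ` {..<k - 2})" using gS(2) by (auto intro!: inj_onI dest: inj_onD)
      show "inj_on ?f (Inr ` {..<l})" using S(3) by (auto intro!: inj_onI dest: inj_onD)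
      show "?f ` (Inl ` {..<k - 2} - Inr ` {..<l}) \<inter> ?f ` (Inr ` {..<l} - Inl ` {..<k - 2}) = {}"
      proof -
        have "?f ` (Inl ` {..<k - 2} - Inr ` {..<l}) \<subseteq> S"
          "?f ` (Inr ` {..<l} - Inl ` {..<k - 2}) \<subseteq> c ` {..<l}"
          using fS fc[of "{..<l}"] by blast+
        then show ?thesis using S(4) by blast
      qed
    qed
    then have iso: "isomorphic ?H ?G'"
      unfolding isomorphic_def by (intro exI[of _ ?f]) (simp add: bij_betw_def)
    have "?f ` (Inl ` {..<k - 2} \<union> Inr ` {i, j}) = insert (c i) (insert (c j) S)" for i j
      by (simp only: image_Un fS fc) simp
    then have eG: "edges ?G' \<subseteq> edges G"
      using e unfolding hypergraph.sel eH image_image by auto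
    have vG: "verts ?G' = S \<union> c ` {..<l}"
      unfolding hypergraph.sel vH image_Un fS fc by (rule refl)
    have iG: "insert (c i) (insert (c (Suc i mod l)) S) \<subseteq> verts G" if "i < l" for i
    proof -
      have "\<forall>e\<in>edges G. e \<subseteq> verts G" using assms(1) by (simp add: uniform_hypergraph_def)
      then show ?thesis using e[OF that] by (rule bspec)
    qed
    have "S \<subseteq> verts G" using iG[of 0] \<open>l \<ge> 1\<close> by simp
    moreover have "c ` {..<l} \<subseteq> verts G" using iG by fast
    ultimately have "verts ?G' \<subseteq> verts G" unfolding vG by (rule Un_least)
    then have "?G' \<in> copies ?H G"
      using iso eG unfolding copies_def subhypergraph_def by blast
    then show ?thesis by (auto simp: free_of_def)
  qed
  ultimately show ?thesis by blast
qed

section \<open>Copies of cliques as vertex sets\<close>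

definition clique_verts :: "nat \<Rightarrow> nat \<Rightarrow> 'a hypergraph \<Rightarrow> 'a set set" where
  "clique_verts k t G =
     {A. A \<subseteq> verts G \<and> card A = t \<and> (\<forall>e. e \<subseteq> A \<and> card e = k \<longrightarrow> e \<in> edges G)}"

lemma bij_betw_image_subsets:
  assumes "bij_betw f A B"
  shows "(\<lambda>e. f ` e) ` {e. e \<subseteq> A \<and> card e = k} = {e. e \<subseteq> B \<and> card e = k}"
proof -
  have B: "B = f ` A" "inj_on f A" using assms by (auto simp: bij_betw_def)
  show ?thesis
  proof (intro equalityI subsetI)
    fix e assume "e \<in> {e. e \<subseteq> B \<and> card e = k}"
    then obtain U where "U \<subseteq> A" "inj_on f U" "e = f ` U" "card e = k"
      using B by (auto simp: subset_image_inj)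
    then show "e \<in> (\<lambda>e. f ` e) ` {e. e \<subseteq> A \<and> card e = k}"
      by (auto simp: card_image)
  next
    fix e assume "e \<in> (\<lambda>e. f ` e) ` {e. e \<subseteq> A \<and> card e = k}"
    then show "e \<in> {e. e \<subseteq> B \<and> card e = k}"
      using B by (auto simp: card_image inj_on_subset)
  qed
qed

text \<open>The edges of a copy of a clique are all \<open>k\<close>-subsets of its vertex set, so
  the copy is determined by that set.\<close>

lemma card_copies_clique:
  assumes "t \<ge> 1"
  shows "card (copies (clique k t) G) = card (clique_verts k t G)"
proof -
  let ?h = "\<lambda>A. Hypergraph A {e. e \<subseteq> A \<and> card e = k}"
  have "copies (clique k t) G = ?h ` clique_verts k t G"
  proof (intro equalityI subsetI)
    fix G' assume "G' \<in> copies (clique k t) G"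
    then obtain f where f: "verts G' \<subseteq> verts G" "edges G' \<subseteq> edges G"
      "bij_betw f {..<t} (verts G')"
      "edges G' = (\<lambda>e. f ` e) ` {e. e \<subseteq> {..<t} \<and> card e = k}"
      by (auto simp: copies_def subhypergraph_def isomorphic_def clique_def)
    have E: "edges G' = {e. e \<subseteq> verts G' \<and> card e = k}"
      unfolding f(4) by (rule bij_betw_image_subsets[OF f(3)])
    have "card (verts G') = t" using bij_betw_same_card[OF f(3)] by simp
    then have "verts G' \<in> clique_verts k t G"
      using f(1,2) E by (auto simp: clique_verts_def)
    moreover have "G' = ?h (verts G')" using E by (cases G') auto
    ultimately show "G' \<in> ?h ` clique_verts k t G" by blast
  next
    fix G' assume "G' \<in> ?h ` clique_verts k t G"
    then obtain A where A: "A \<in> clique_verts k t G" "G' = ?h A" by blast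
    \<comment> \<open>Infinite sets have cardinality 0, so \<open>t \<ge> 1\<close> guarantees that
      \<open>A\<close> is finite.\<close>
    then have "card A = t" "finite A"
      using \<open>t \<ge> 1\<close> by (auto simp: clique_verts_def intro: card_ge_0_finite)
    then obtain f where f: "bij_betw f {..<t} A"
      using ex_bij_betw_nat_finite[of A] by (auto simp: atLeast0LessThan)
    then have "isomorphic (clique k t) G'"
      unfolding isomorphic_def clique_def A(2) hypergraph.sel
      using bij_betw_image_subsets[OF f, of k] by metis
    then show "G' \<in> copies (clique k t) G"
      using A by (auto simp: copies_def subhypergraph_def clique_verts_def)
  qed
  moreover have "inj_on ?h (clique_verts k t G)" by (auto simp: inj_on_def)
  ultimately show ?thesis by (simp add: card_image)
qed

lemma card_subsets_le:
  assumes "finite V"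
  shows "card {A. A \<subseteq> V \<and> card A = r} \<le> card V ^ r"
  using assms binomial_le_pow[of r "card V"] by (cases "r \<le> card V") (auto simp: n_subsets not_le binomial_eq_0)

text \<open>Splitting off a \<open>(k - 2)\<close>-subset \<open>S\<close> from a clique leaves a
  clique of the link graph of \<open>S\<close>, and there are at most
  \<open>card (verts G) ^ (k - 2)\<close> choices for \<open>S\<close>.\<close>

lemma card_clique_verts_le:
  assumes "finite (verts G)" "2 \<le> k" "k \<le> t"
    and B: "\<And>S. S \<subseteq> verts G \<Longrightarrow> card S = k - 2 \<Longrightarrow>
              card (clique_sets (link (edges G) S) (t - (k - 2)) (verts G)) \<le> B"
  shows "card (clique_verts k t G) \<le> card (verts G) ^ (k - 2) * B"
proof -
  let ?V = "verts G"
  let ?I = "{S. S \<subseteq> ?V \<and> card S = k - 2}"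
  let ?C = "\<lambda>S. clique_sets (link (edges G) S) (t - (k - 2)) ?V"
  have finI: "finite ?I" using assms(1) by (auto intro: finite_subset[of _ "Pow ?V"])
  have finC: "finite (?C S)" for S
    using assms(1) by (auto simp: clique_sets_def intro: finite_subset[of _ "Pow ?V"])
  have "clique_verts k t G \<subseteq> (\<Union>S\<in>?I. (\<lambda>B. S \<union> B) ` ?C S)"
  proof
    fix A assume "A \<in> clique_verts k t G"
    then have A: "A \<subseteq> ?V" "card A = t" "\<And>e. e \<subseteq> A \<Longrightarrow> card e = k \<Longrightarrow> e \<in> edges G"
      by (auto simp: clique_verts_def)
    then have "k - 2 \<le> card A" using assms(3) by simp
    then obtain S where S: "S \<subseteq> A" "card S = k - 2" "finite S"
      by (rule obtain_subset_with_card_n)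
    have "insert x (insert y S) \<in> edges G" if "x \<in> A - S" "y \<in> A - S" "x \<noteq> y" for x y
      using S that \<open>2 \<le> k\<close> by (intro A(3)) auto
    then have "A - S \<in> ?C S"
      using A S by (auto simp: clique_sets_def link_def card_Diff_subset)
    moreover have "A = S \<union> (A - S)" using S by blast
    ultimately show "A \<in> (\<Union>S\<in>?I. (\<lambda>B. S \<union> B) ` ?C S)"
      using S A(1) by blast
  qed
  then have "card (clique_verts k t G) \<le> card (\<Union>S\<in>?I. (\<lambda>B. S \<union> B) ` ?C S)"
    using finI finC by (intro card_mono) auto
  also have "\<dots> \<le> (\<Sum>S\<in>?I. card ((\<lambda>B. S \<union> B) ` ?C S))"
    by (rule card_UN_le[OF finI])
  also have "\<dots> \<le> (\<Sum>S\<in>?I. B)"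
    by (intro sum_mono order_trans[OF card_image_le B] finC) auto
  also have "\<dots> \<le> card ?V ^ (k - 2) * B"
    using card_subsets_le[OF assms(1)] by simp
  finally show ?thesis .
qed

section \<open>Upper bounds on the extremal number\<close>

lemma ex_num_le:
  assumes "edges H \<noteq> {}"
    and "\<And>G :: nat hypergraph. \<lbrakk>uniform_hypergraph k G; card (verts G) = n; free_of H G\<rbrakk>
           \<Longrightarrow> card (copies T G) \<le> B"
  shows "ex_num k n T H \<le> B"
  unfolding ex_num_def
  using finite_copy_counts[of k n T H] copy_counts_nonempty[OF assms(1), of k n T] assms(2)
  by (auto simp: copy_counts_def)

lemma ex_num_ge:
  fixes G :: "nat hypergraph"
  assumes "uniform_hypergraph k G" "card (verts G) = n" "free_of H G"
  shows "card (copies T G) \<le> ex_num k n T H"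
  unfolding ex_num_def
  using finite_copy_counts assms by (intro Max_ge) (auto simp: copy_counts_def)

text \<open>Every link of a \<open>(k - 2)\<close>-set is a graph without \<open>l\<close>-cycles,
  so its cliques are counted by its arcs. It remains to supply a bound \<open>B\<close> on the
  number of arcs.\<close>

lemma ex_num_clique_le:
  assumes "2 \<le> k" "3 \<le> l" "k \<le> t" "t < k + l - 2"
    and B: "\<And>E V :: nat set. \<lbrakk>finite V; card V = n; symp E; irreflp E; \<not> has_cycle E l\<rbrakk>
              \<Longrightarrow> card (SIGMA x:V. nbrs E V x) \<le> B"
  shows "ex_num k n (clique k t) (suspension k (cycle_graph l)) \<le> n ^ (k - 2) * (2 ^ l * B)"
proof (rule ex_num_le)
  have "0 < l" using assms by simp
  then show "edges (suspension k (cycle_graph l)) \<noteq> {}"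
    by (auto simp: suspension_def cycle_graph_def)
next
  fix G :: "nat hypergraph"
  assume G: "uniform_hypergraph k G" "card (verts G) = n"
    "free_of (suspension k (cycle_graph l)) G"
  have fin: "finite (verts G)" using G by (simp add: uniform_hypergraph_def)
  have "card (clique_sets (link (edges G) S) (t - (k - 2)) (verts G)) \<le> 2 ^ l * B"
    if S: "S \<subseteq> verts G" "card S = k - 2" for S
  proof -
    have nc: "\<not> has_cycle (link (edges G) S) l"
      using has_cycle_link[of "edges G" S l k] S finite_subset[OF S(1) fin] \<open>3 \<le> l\<close> G
        free_of_suspension_iff[of k G l] by auto
    have "card (clique_sets (link (edges G) S) (t - (k - 2)) (verts G))
        \<le> 2 ^ l * card (SIGMA x:verts G. nbrs (link (edges G) S) (verts G) x)"
      using assms fin nc by (intro card_cliques_cycle_free symp_link irreflp_link) auto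
    also have "\<dots> \<le> 2 ^ l * B"
      using B[OF fin G(2) symp_link irreflp_link nc] by simp
    finally show ?thesis .
  qed
  then have "card (clique_verts k t G) \<le> card (verts G) ^ (k - 2) * (2 ^ l * B)"
    using assms fin by (intro card_clique_verts_le) auto
  then show "card (copies (clique k t) G) \<le> n ^ (k - 2) * (2 ^ l * B)"
    using G assms by (simp add: card_copies_clique)
qed

lemma ex_num_clique_le_power:
  assumes "2 \<le> k" "3 \<le> l" "k \<le> t" "t < k + l - 2"
  shows "ex_num k n (clique k t) (suspension k (cycle_graph l)) \<le> 2 ^ l * n ^ k"
proof -
  have "ex_num k n (clique k t) (suspension k (cycle_graph l)) \<le> n ^ (k - 2) * (2 ^ l * n ^ 2)"
  proof (rule ex_num_clique_le[OF assms])
    fix E and V :: "nat set"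
    assume V: "finite V" "card V = n"
    have "card (SIGMA x:V. nbrs E V x) \<le> card (V \<times> V)"
      using V by (intro card_mono) (auto simp: nbrs_def)
    then show "card (SIGMA x:V. nbrs E V x) \<le> n ^ 2"
      using V by (simp add: card_cartesian_product power2_eq_square)
  qed
  also have "\<dots> = 2 ^ l * n ^ (k - 2 + 2)" unfolding power_add by (simp only: mult_ac)
  also have "k - 2 + 2 = k" using assms by simp
  finally show ?thesis .
qed

lemma ex_num_clique_le_even:
  assumes "2 \<le> k" "3 \<le> 2 * m" "k \<le> t" "t < k + 2 * m - 2" "n \<ge> 1"
  shows "real (ex_num k n (clique k t) (suspension k (cycle_graph (2 * m))))
           \<le> 2 ^ (2 * m) * 28 * m * real n powr (real k - 1 + 2 / real (2 * m))"
proof -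
  define r where "r = real n powr (1 / m)"
  \<comment> \<open>The least integer exceeding the \<open>m\<close>-th root of \<open>n\<close>, so
    that \<open>a ^ m > n\<close> while \<open>a\<close> stays of order \<open>r\<close>.\<close>
  define a where "a = nat \<lfloor>r\<rfloor> + 1"
  have m: "m \<ge> 2" using assms by simp
  have r1: "r \<ge> 1" using \<open>n \<ge> 1\<close> by (simp add: r_def ge_one_powr_ge_zero)
  have a: "r < real a" "real a \<le> r + 1" 
  proof -
    have "real a = of_int \<lfloor>r\<rfloor> + 1" using r1 by (simp add: a_def)
    then show "r < real a" "real a \<le> r + 1" using floor_correct[of r] by linarith+
  qed
  have "r ^ m = r powr real m" using r1 by (subst powr_realpow) auto
  then have "real n = r ^ m"
    using m \<open>n \<ge> 1\<close> by (simp add: r_def powr_powr)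
  also have "\<dots> < real a ^ m" using a r1 m by (intro power_strict_mono) auto
  finally have "n < a ^ m" by (simp flip: of_nat_power)
  then have "ex_num k n (clique k t) (suspension k (cycle_graph (2 * m)))
      \<le> n ^ (k - 2) * (2 ^ (2 * m) * (4 * m * (5 + a) * n))"
    using assms by (intro ex_num_clique_le even_cycle_free_card_arcs[of _ _ m a, THEN order_trans])
      (auto simp: a_def)
  then have "real (ex_num k n (clique k t) (suspension k (cycle_graph (2 * m))))
      \<le> real (n ^ (k - 2) * (2 ^ (2 * m) * (4 * m * (5 + a) * n)))"
    by (rule of_nat_mono)
  also have "\<dots> = 2 ^ (2 * m) * 4 * m * (5 + real a) * real n ^ (k - 2 + 1)"
    by simp
  \<comment> \<open>Here \<open>5 + a \<le> 6 + r \<le> 7 * r\<close>, as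
    \<open>r \<ge> 1\<close>.\<close>
  also have "\<dots> \<le> 2 ^ (2 * m) * 4 * m * (7 * r) * real n ^ (k - 2 + 1)"
    using a r1 by (intro mult_right_mono mult_left_mono) auto
  also have "\<dots> = 2 ^ (2 * m) * 28 * real m * (real n powr (1 / m) * real n powr real (k - 2 + 1))"
    using \<open>n \<ge> 1\<close> by (subst powr_realpow) (auto simp: r_def)
  also have "real n powr (1 / m) * real n powr real (k - 2 + 1)
      = real n powr (real k - 1 + 2 / real (2 * m))"
    using assms(1) by (simp add: of_nat_diff algebra_simps flip: powr_add)
  finally show ?thesis by simp
qed

section \<open>A maximal family with suspended-cycle-free shadow\<close>

definition shadow :: "nat \<Rightarrow> 'a set set \<Rightarrow> 'a set set" where
  "shadow k F = {e. card e = k \<and> (\<exists>A\<in>F. e \<subseteq> A)}"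

text \<open>The ends of walks of \<open>j\<close> steps from \<open>x\<close> in the link of
  \<open>S\<close> in the shadow of \<open>F\<close>, where a step moves within one member of
  \<open>F\<close> that contains \<open>S\<close>. Walks may also pause, which only enlarges the
  set.\<close>

fun reach :: "'a set set \<Rightarrow> 'a set \<Rightarrow> 'a \<Rightarrow> nat \<Rightarrow> 'a set" where
  "reach F S x 0 = {x}"
| "reach F S x (Suc j) = (\<Union>z\<in>reach F S x j. \<Union>A\<in>{A \<in> F. insert z S \<subseteq> A}. A - S)"

section \<open>Short walks in links\<close>

lemma card_UN_le_mult:
  assumes "finite I" "\<And>i. i \<in> I \<Longrightarrow> card (f i) \<le> b"
  shows "card (\<Union>i\<in>I. f i) \<le> card I * b"
proof -
  have "card (\<Union>i\<in>I. f i) \<le> (\<Sum>i\<in>I. card (f i))" by (rule card_UN_le[OF assms(1)])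
  also have "\<dots> \<le> (\<Sum>i\<in>I. b)" by (intro sum_mono assms(2))
  finally show ?thesis by simp
qed

text \<open>For \<open>z\<close> outside \<open>S\<close>, the set \<open>insert z S\<close> has
  \<open>k - 1\<close> elements and lies in at most \<open>d\<close> members of \<open>F\<close>,
  each with at most \<open>t\<close> vertices. So every step multiplies the count by at most
  \<open>d * t\<close>.\<close>

lemma card_reach_le:
  assumes "finite F" "\<And>A. A \<in> F \<Longrightarrow> finite A \<and> card A \<le> t"
    and deg: "\<And>T. card T = k - 1 \<Longrightarrow> card {A \<in> F. T \<subseteq> A} \<le> d"
    and S: "finite S" "card S = k - 2" "2 \<le> k" and "x \<notin> S"
  shows "finite (reach F S x j) \<and> reach F S x j \<inter> S = {} \<and> card (reach F S x j) \<le> (d * t) ^ j"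
proof (induction j)
  case (Suc j)
  have "card (\<Union>A\<in>{A \<in> F. insert z S \<subseteq> A}. A - S) \<le> d * t" if z: "z \<in> reach F S x j" for z
  proof -
    have "card (insert z S) = k - 1" using z Suc.IH S by (auto simp: card_insert_if)
    then have "card {A \<in> F. insert z S \<subseteq> A} \<le> d" by (rule deg)
    moreover have "card (A - S) \<le> t" if "A \<in> F" for A
      using assms(2)[OF that] card_mono[of A "A - S"] by auto
    then have "card (\<Union>A\<in>{A \<in> F. insert z S \<subseteq> A}. A - S) \<le> card {A \<in> F. insert z S \<subseteq> A} * t"
      using \<open>finite F\<close> by (intro card_UN_le_mult) auto
    ultimately show ?thesis using mult_le_mono1 order_trans by blast
  qed
  then have "card (reach F S x (Suc j)) \<le> card (reach F S x j) * (d * t)"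
    unfolding reach.simps using Suc.IH by (intro card_UN_le_mult) auto
  also have "\<dots> \<le> (d * t) ^ j * (d * t)" using Suc.IH by (intro mult_le_mono1) simp
  finally have "card (reach F S x (Suc j)) \<le> (d * t) ^ Suc j" by (simp add: mult_ac)
  moreover have "finite (reach F S x (Suc j))"
    unfolding reach.simps using Suc.IH assms(1,2) by (intro finite_UN_I finite_Diff) auto
  moreover have "reach F S x (Suc j) \<inter> S = {}" by auto
  ultimately show ?case by blast
qed (use assms in auto)

text \<open>Every new edge of the cycle lies inside \<open>A\<close>. Not all edges are new, since
  \<open>A\<close> is too small, and not all are old. Hence there is a maximal run of old edges
  around the cycle, and it is a walk between two distinct vertices of \<open>A\<close>.\<close>

lemma suspended_cycle_insert:
  assumes cyc: "suspended_cycle k l (shadow k (insert A F)) S c"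
    and nocyc: "\<not> suspended_cycle k l (shadow k F) S c"
    and A: "finite A" "card A < k + l - 2" and "2 \<le> k" "3 \<le> l"
  shows "S \<subseteq> A \<and> (\<exists>x\<in>A - S. \<exists>y\<in>A - S. x \<noteq> y \<and> (\<exists>j\<in>{1..l - 1}. y \<in> reach F S x j))"
proof -
  have S: "finite S" "card S = k - 2" "inj_on c {..<l}" "c ` {..<l} \<inter> S = {}"
    and ce: "\<And>i. i < l \<Longrightarrow> insert (c i) (insert (c (Suc i mod l)) S) \<in> shadow k (insert A F)"
    using cyc by (auto simp: suspended_cycle_def)
  \<comment> \<open>The cycle is unrolled periodically so that runs need no reduction modulo
    \<open>l\<close>. \<open>P i\<close> marks the edges that are already present without
    \<open>A\<close>.\<close>
  define e where "e i = c (i mod l)" for i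
  define P where "P i \<longleftrightarrow> insert (e i) (insert (e (Suc i)) S) \<in> shadow k F" for i
  have eS: "e i \<notin> S" for i
  proof -
    have "i mod l \<in> {..<l}" using \<open>3 \<le> l\<close> by simp
    then show ?thesis using S(4) unfolding e_def by blast
  qed
  have e: "insert (e i) (insert (e (Suc i)) S) \<in> shadow k (insert A F)" for i
    using ce[of "i mod l"] \<open>3 \<le> l\<close> by (simp add: e_def mod_Suc_eq)
  have nP: "insert (e i) (insert (e (Suc i)) S) \<subseteq> A" if "\<not> P i" for i
    using e[of i] that by (auto simp: P_def shadow_def)
  have per: "P (i + q * l) = P i" for i q
    using mod_mult_self1[of i q l] mod_mult_self1[of "Suc i" q l]
    by (simp add: P_def e_def)
  have "\<exists>i. \<not> P i"
  proof (rule ccontr)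
    assume all: "\<nexists>i. \<not> P i"
    have "insert (c i) (insert (c (Suc i mod l)) S) \<in> shadow k F" if "i < l" for i
    proof -
      have "P i" using all by blast
      then show ?thesis using that by (simp add: P_def e_def)
    qed
    then show False using nocyc S by (simp add: suspended_cycle_def)
  qed
  then obtain i0 where i0: "\<not> P i0" by blast
  have "\<exists>i. P i"
  proof (rule ccontr)
    assume all: "\<nexists>i. P i"
    have "e i \<in> A" for i using nP[of i] all by blast
    then have "c i \<in> A" if "i < l" for i using that by (metis e_def mod_less)
    then have "S \<union> c ` {..<l} \<subseteq> A" using nP[OF i0] by auto
    then have "card (S \<union> c ` {..<l}) \<le> card A" using A by (intro card_mono)
    moreover have "card (S \<union> c ` {..<l}) = (k - 2) + l"
      using S by (subst card_Un_disjoint) (auto simp: card_image)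
    ultimately show False using A \<open>2 \<le> k\<close> by simp
  qed
  then obtain i1 where "P i1" by blast
  then have ex: "i0 \<le> i1 + i0 * l \<and> P (i1 + i0 * l)"
    using per[of i1 i0] \<open>3 \<le> l\<close> by (simp add: trans_le_add2)
  \<comment> \<open>The first old edge at or after the new edge \<open>i0\<close>; the edge
    \<open>b\<close> just before it is therefore new.\<close>
  define a where "a = (LEAST a. i0 \<le> a \<and> P a)"
  have a: "i0 \<le> a" "P a" unfolding a_def
    using LeastI[of "\<lambda>a. i0 \<le> a \<and> P a", OF ex] by blast+
  have "a \<noteq> i0" using a i0 by blast
  then obtain b where b: "a = Suc b" "i0 \<le> b" using a(1) by (cases a) auto
  have nPb: "\<not> P b"
    using not_less_Least[of b "\<lambda>a. i0 \<le> a \<and> P a"] b by (simp add: a_def[symmetric])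
  \<comment> \<open>One full turn after \<open>b\<close> the same new edge returns, so the run of
    old edges starting at \<open>a\<close> has length at most \<open>l - 1\<close>.\<close>
  have exj: "\<not> P (a + (l - 1))"
  proof -
    have "a + (l - 1) = b + 1 * l" using b \<open>3 \<le> l\<close> by simp
    then show ?thesis using per[of b 1] nPb by simp
  qed
  define j where "j = (LEAST j. \<not> P (a + j))"
  have j: "\<not> P (a + j)" "j \<le> l - 1" unfolding j_def
    using LeastI[of "\<lambda>j. \<not> P (a + j)", OF exj] Least_le[of "\<lambda>j. \<not> P (a + j)", OF exj] by blast+
  have jP: "P (a + i)" if "i < j" for i
    using not_less_Least[of i "\<lambda>j. \<not> P (a + j)"] that by (simp add: j_def)
  have "j \<noteq> 0" using j a by (cases j) auto
  have "e (a + i) \<in> reach F S (e a) i" if "i \<le> j" for i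
    using that
  proof (induction i)
    case (Suc i)
    then obtain B where "B \<in> F" "insert (e (a + i)) (insert (e (Suc (a + i))) S) \<subseteq> B"
      using jP[of i] by (auto simp: P_def shadow_def)
    then show ?case using Suc eS by auto
  qed simp
  then have "e (a + j) \<in> reach F S (e a) j" by simp
  moreover have "e a \<in> A" "e (a + j) \<in> A" "S \<subseteq> A"
    using nP[OF nPb] nP[OF j(1)] b by auto
  \<comment> \<open>The run has between 1 and \<open>l - 1\<close> edges, so it does not close
    up.\<close>
  moreover have "e a \<noteq> e (a + j)"
  proof
    assume "e a = e (a + j)"
    then have "a mod l = (a + j) mod l"
      using inj_onD[OF S(3), of "a mod l" "(a + j) mod l"] \<open>3 \<le> l\<close> by (simp add: e_def)
    then have "l dvd (a + j) - a" using mod_eq_dvd_iff_nat[of a "a + j" l] by simp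
    then have "l \<le> j" using \<open>j \<noteq> 0\<close> by (auto dest: dvd_imp_le)
    then show False using j(2) \<open>3 \<le> l\<close> by simp
  qed
  moreover have "j \<in> {1..l - 1}" using j(2) \<open>j \<noteq> 0\<close> by simp
  ultimately show ?thesis using eS by blast
qed

section \<open>Maximal families and the sets blocking their extension\<close>

lemma card_supersets_le:
  assumes "finite V" "finite T"
  shows "card {A. T \<subseteq> A \<and> A \<subseteq> V \<and> card A = t} \<le> card V ^ (t - card T)"
proof -
  let ?R = "{B. B \<subseteq> V \<and> card B = t - card T}"
  have fR: "finite ?R" using \<open>finite V\<close> by (auto intro: finite_subset[of _ "Pow V"])
  have "{A. T \<subseteq> A \<and> A \<subseteq> V \<and> card A = t} \<subseteq> (\<lambda>B. T \<union> B) ` ?R"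
  proof
    fix A assume A: "A \<in> {A. T \<subseteq> A \<and> A \<subseteq> V \<and> card A = t}"
    then have "A - T \<in> ?R" "A = T \<union> (A - T)"
      using \<open>finite T\<close> by (auto simp: card_Diff_subset)
    then show "A \<in> (\<lambda>B. T \<union> B) ` ?R" by blast
  qed
  then have "card {A. T \<subseteq> A \<and> A \<subseteq> V \<and> card A = t} \<le> card ?R"
    using fR by (rule surj_card_le[rotated])
  also have "\<dots> \<le> card V ^ (t - card T)" by (rule card_subsets_le[OF \<open>finite V\<close>])
  finally show ?thesis .
qed

text \<open>By maximality every \<open>t\<close>-set is in \<open>F\<close>, contains a
  \<open>(k - 1)\<close>-set whose degree is already \<open>d\<close>, or would create a suspended
  cycle. Counting the three kinds gives the inequality, multiplied by \<open>d\<close> to stay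
  within the natural numbers.\<close>

lemma exists_maximal_family:
  fixes V :: "'a set"
  assumes "2 \<le> k" "3 \<le> l" "k \<le> t" "t < k + l - 2" "d \<ge> 1" "finite V"
  defines "n \<equiv> card V"
  shows "\<exists>F. F \<subseteq> {A. A \<subseteq> V \<and> card A = t} \<and> (\<nexists>S c. suspended_cycle k l (shadow k F) S c) \<and>
           d * (n choose t) \<le> (d + 2 ^ t * n ^ (t - k + 1)) * card F +
             d * (l * (d * t) ^ (l - 1) * n ^ (t - 1))"
proof -
  let ?all = "{A. A \<subseteq> V \<and> card A = t}"
  define good where "good F \<longleftrightarrow> (\<forall>T. card T = k - 1 \<longrightarrow> card {A \<in> F. T \<subseteq> A} \<le> d) \<and>
    (\<nexists>S c. suspended_cycle k l (shadow k F) S c)" for F :: "'a set set"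
  have finall: "finite ?all" using \<open>finite V\<close> by (auto intro: finite_subset[of _ "Pow V"])
  have "good {}"
    using assms by (auto simp: good_def shadow_def suspended_cycle_def intro!: exI[of _ 0])
  then have "{} \<in> {F \<in> Pow ?all. good F}" by simp
  then obtain F where F: "F \<in> {F \<in> Pow ?all. good F}"
    and max: "\<And>F'. F' \<in> {F \<in> Pow ?all. good F} \<Longrightarrow> F \<subseteq> F' \<Longrightarrow> F = F'"
    using finite_has_maximal[of "{F \<in> Pow ?all. good F}"] finall by auto
  have Fall: "F \<subseteq> ?all" and degF: "\<And>T. card T = k - 1 \<Longrightarrow> card {A \<in> F. T \<subseteq> A} \<le> d"
    and nocyc: "\<nexists>S c. suspended_cycle k l (shadow k F) S c"
    using F by (auto simp: good_def)
  have finF: "finite F" using Fall finall finite_subset by blast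
  have finA: "finite A" if "A \<subseteq> V" for A using that \<open>finite V\<close> finite_subset by blast
  define supers where "supers T = {A. T \<subseteq> A \<and> A \<subseteq> V \<and> card A = t}" for T
  define Sat where "Sat = {T. T \<subseteq> V \<and> card T = k - 1 \<and> d \<le> card {A \<in> F. T \<subseteq> A}}"
  define I where "I = {S. S \<subseteq> V \<and> card S = k - 2}"
  have finSat: "finite Sat" and finI: "finite I"
    using \<open>finite V\<close> by (auto simp: Sat_def I_def intro: finite_subset[of _ "Pow V"])
  have finsup: "finite (supers T)" for T
    using finall by (auto simp: supers_def intro: finite_subset[of _ ?all])
  \<comment> \<open>\<open>bad2\<close> collects the sets that break the degree bound,
    \<open>bad3\<close> those that contain some \<open>S\<close> and both ends of a walk of at most
    \<open>l - 1\<close> steps in the link of \<open>S\<close>.\<close>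
  define bad2 where "bad2 = (\<Union>T\<in>Sat. supers T)"
  define bad3 where "bad3 = (\<Union>S\<in>I. \<Union>x\<in>V - S. \<Union>j\<in>{1..l - 1}. \<Union>y\<in>reach F S x j - {x}.
    supers (insert x (insert y S)))"
  have reach: "finite (reach F S x j) \<and> reach F S x j \<inter> S = {} \<and> card (reach F S x j) \<le> (d * t) ^ j"
    if "S \<in> I" "x \<notin> S" for S x j
    using that Fall finA degF \<open>2 \<le> k\<close> finF
    by (intro card_reach_le[where k = k]) (auto simp: I_def)
  have "?all \<subseteq> F \<union> bad2 \<union> bad3"
  proof
    fix A assume A: "A \<in> ?all"
    show "A \<in> F \<union> bad2 \<union> bad3"
    proof (rule ccontr)
      assume "\<not> ?thesis"
      then have nA: "A \<notin> F" "A \<notin> bad2" "A \<notin> bad3" by auto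
      have deg: "card {B \<in> insert A F. T \<subseteq> B} \<le> d" if T: "card T = k - 1" for T
      proof (cases "T \<subseteq> A")
        case True
        then have "\<not> d \<le> card {B \<in> F. T \<subseteq> B}"
          using nA(2) A T by (auto simp: bad2_def Sat_def supers_def)
        moreover have "{B \<in> insert A F. T \<subseteq> B} = insert A {B \<in> F. T \<subseteq> B}"
          using True by auto
        ultimately show ?thesis using finF nA(1) by simp
      next
        case False
        then have "{B \<in> insert A F. T \<subseteq> B} = {B \<in> F. T \<subseteq> B}" by auto
        then show ?thesis using degF[OF T] by simp
      qed
      have "\<not> suspended_cycle k l (shadow k (insert A F)) S c" for S c
      proof
        assume sc: "suspended_cycle k l (shadow k (insert A F)) S c"
        then have "card S = k - 2" by (simp add: suspended_cycle_def)
        moreover have "S \<subseteq> A \<and> (\<exists>x\<in>A - S. \<exists>y\<in>A - S. x \<noteq> y \<and> (\<exists>j\<in>{1..l - 1}. y \<in> reach F S x j))"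
          using sc nocyc A finA assms by (intro suspended_cycle_insert[where k = k and c = c]) auto
        ultimately obtain x y j where xy: "card S = k - 2" "S \<subseteq> A" "x \<in> A - S" "y \<in> A - S" "x \<noteq> y"
          "j \<in> {1..l - 1}" "y \<in> reach F S x j"
          by blast
        have "S \<in> I" "x \<in> V - S" "y \<in> reach F S x j - {x}" "A \<in> supers (insert x (insert y S))"
          using xy A by (auto simp: I_def supers_def)
        with xy(6) have "A \<in> bad3" unfolding bad3_def by (intro UN_I)
        then show False using nA by blast
      qed
      then have "good (insert A F)" using deg unfolding good_def by blast
      then have "F = insert A F" using Fall A by (intro max) auto
      then show False using nA(1) by blast
    qed
  qed
  moreover have "finite bad2" using finSat finsup by (simp add: bad2_def)
  moreover have "finite bad3"
    unfolding bad3_def using finI finsup \<open>finite V\<close> reach by (intro finite_UN_I) auto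
  ultimately have "card ?all \<le> card (F \<union> bad2 \<union> bad3)" using finF by (intro card_mono) auto
  also have "\<dots> \<le> card F + card bad2 + card bad3"
    by (meson add_right_mono card_Un_le order_trans)
  finally have total: "n choose t \<le> card F + card bad2 + card bad3"
    using \<open>finite V\<close> by (simp add: n_subsets n_def)
  have "card (supers T) \<le> n ^ (t - k + 1)" if "T \<in> Sat" for T
  proof -
    have "card (supers T) \<le> n ^ (t - card T)"
      unfolding supers_def n_def using that \<open>finite V\<close> finA
      by (intro card_supersets_le) (auto simp: Sat_def)
    moreover have "t - card T = t - k + 1" using that assms by (simp add: Sat_def)
    ultimately show ?thesis by simp
  qed
  then have b2: "card bad2 \<le> card Sat * n ^ (t - k + 1)"
    unfolding bad2_def by (intro card_UN_le_mult finSat)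
  \<comment> \<open>Double counting of pairs of a saturated set and a member of \<open>F\<close>
    containing it: a saturated set has at least \<open>d\<close> such members, and a member has at
    most \<open>2 ^ t\<close> subsets.\<close>
  have "d * card Sat = (\<Sum>T\<in>Sat. d)" by simp
  also have "\<dots> \<le> (\<Sum>T\<in>Sat. card {A \<in> F. T \<subseteq> A})" by (intro sum_mono) (simp add: Sat_def)
  also have "\<dots> = card (SIGMA T:Sat. {A \<in> F. T \<subseteq> A})" using finF finSat by simp
  also have "\<dots> \<le> card (prod.swap ` (SIGMA A:F. Pow A))"
    using finF Fall finA by (intro card_mono finite_imageI finite_SigmaI) auto
  also have "\<dots> \<le> card (SIGMA A:F. Pow A)"
    using finF Fall finA by (intro card_image_le finite_SigmaI) auto
  also have "\<dots> = (\<Sum>A\<in>F. card (Pow A))"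
    using finF Fall finA by (intro card_SigmaI) auto
  also have "\<dots> = (\<Sum>A\<in>F. 2 ^ t)"
    using Fall finA by (intro sum.cong) (auto simp: card_Pow)
  finally have sat: "d * card Sat \<le> card F * 2 ^ t" by simp
  have "card (supers (insert x (insert y S))) \<le> n ^ (t - k)"
    if "S \<in> I" "x \<in> V - S" "y \<in> reach F S x j - {x}" for S x y j
  proof -
    have "finite S" "y \<notin> S" "card S = k - 2" using that reach[of S x j] finA by (auto simp: I_def)
    then have "card (insert x (insert y S)) = k" "finite (insert x (insert y S))"
      using that \<open>2 \<le> k\<close> by auto
    then show ?thesis
      using card_supersets_le[OF \<open>finite V\<close>, of "insert x (insert y S)" t] by (simp only: supers_def n_def)
  qed
  note sup3 = this
  have step1: "card (\<Union>y\<in>reach F S x j - {x}. supers (insert x (insert y S))) \<le> (d * t) ^ (l - 1) * n ^ (t - k)"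
    if "S \<in> I" "x \<in> V - S" "j \<in> {1..l - 1}" for S x j
  proof -
    have r: "finite (reach F S x j)" "card (reach F S x j) \<le> (d * t) ^ j" using reach that by auto
    have "card (\<Union>y\<in>reach F S x j - {x}. supers (insert x (insert y S)))
        \<le> card (reach F S x j - {x}) * n ^ (t - k)"
      using r(1) sup3[OF that(1,2)] by (intro card_UN_le_mult) auto
    also have "card (reach F S x j - {x}) \<le> card (reach F S x j)"
      using r(1) by (intro card_mono) auto
    also have "\<dots> \<le> (d * t) ^ j" by (rule r(2))
    also have "\<dots> \<le> (d * t) ^ (l - 1)"
      using that assms by (intro power_increasing) auto
    finally show ?thesis by simp
  qed
  have step2: "card (\<Union>j\<in>{1..l - 1}. \<Union>y\<in>reach F S x j - {x}. supers (insert x (insert y S)))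
      \<le> card {1..l - 1} * ((d * t) ^ (l - 1) * n ^ (t - k))" if "S \<in> I" "x \<in> V - S" for S x
    by (rule card_UN_le_mult[OF _ step1[OF that]]) auto
  have step3: "card (\<Union>x\<in>V - S. \<Union>j\<in>{1..l - 1}. \<Union>y\<in>reach F S x j - {x}. supers (insert x (insert y S)))
      \<le> n * (l * ((d * t) ^ (l - 1) * n ^ (t - k)))" if "S \<in> I" for S
  proof -
    have "card (\<Union>x\<in>V - S. \<Union>j\<in>{1..l - 1}. \<Union>y\<in>reach F S x j - {x}. supers (insert x (insert y S)))
        \<le> card (V - S) * (card {1..l - 1} * ((d * t) ^ (l - 1) * n ^ (t - k)))"
      by (rule card_UN_le_mult[OF _ step2[OF that]]) (use \<open>finite V\<close> in auto)
    also have "\<dots> \<le> n * (l * ((d * t) ^ (l - 1) * n ^ (t - k)))"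
      unfolding n_def using \<open>finite V\<close> by (intro mult_le_mono card_mono) auto
    finally show ?thesis .
  qed
  \<comment> \<open>The factors count the choices of \<open>S\<close>, the start \<open>x\<close>,
    the length \<open>j\<close>, the end \<open>y\<close>, and the remaining \<open>t - k\<close>
    vertices.\<close>
  have "card bad3 \<le> card I * (n * (l * ((d * t) ^ (l - 1) * n ^ (t - k))))"
    unfolding bad3_def by (rule card_UN_le_mult[OF finI step3])
  also have "\<dots> \<le> n ^ (k - 2) * (n * (l * ((d * t) ^ (l - 1) * n ^ (t - k))))"
    using card_subsets_le[OF \<open>finite V\<close>, of "k - 2"] by (intro mult_le_mono1) (simp add: I_def n_def)
  also have "\<dots> = l * (d * t) ^ (l - 1) * n ^ ((k - 2) + 1 + (t - k))"
    by (simp add: power_add mult_ac)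
  also have "(k - 2) + 1 + (t - k) = t - 1" using assms by simp
  finally have b3: "card bad3 \<le> l * (d * t) ^ (l - 1) * n ^ (t - 1)" .
  have "d * (n choose t) \<le> d * (card F + card bad2 + card bad3)"
    using total by (rule mult_le_mono2)
  also have "\<dots> = d * card F + d * card bad2 + d * card bad3" by (simp add: algebra_simps)
  also have "\<dots> \<le> d * card F + d * (card Sat * n ^ (t - k + 1)) +
      d * (l * (d * t) ^ (l - 1) * n ^ (t - 1))"
    using b2 b3 by (intro add_mono mult_le_mono2) auto
  also have "d * (card Sat * n ^ (t - k + 1)) \<le> card F * 2 ^ t * n ^ (t - k + 1)"
    using mult_le_mono1[OF sat, of "n ^ (t - k + 1)"] by (simp only: mult.assoc)
  finally have "d * (n choose t) \<le> (d + 2 ^ t * n ^ (t - k + 1)) * card F +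
      d * (l * (d * t) ^ (l - 1) * n ^ (t - 1))"
    by (simp add: algebra_simps)
  then show ?thesis using Fall nocyc by blast
qed

text \<open>The shadow of the maximal family serves as the host: each member of \<open>F\<close>
  spans a clique in it.\<close>

lemma ex_num_clique_ge:
  assumes "2 \<le> k" "3 \<le> l" "k \<le> t" "t < k + l - 2" "d \<ge> 1"
  shows "d * (n choose t) \<le>
    (d + 2 ^ t * n ^ (t - k + 1)) * ex_num k n (clique k t) (suspension k (cycle_graph l)) +
    d * (l * (d * t) ^ (l - 1) * n ^ (t - 1))"
proof -
  let ?V = "{..<n}"
  obtain F where F: "F \<subseteq> {A. A \<subseteq> ?V \<and> card A = t}" "\<nexists>S c. suspended_cycle k l (shadow k F) S c"
    "d * (n choose t) \<le> (d + 2 ^ t * n ^ (t - k + 1)) * card F +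
       d * (l * (d * t) ^ (l - 1) * n ^ (t - 1))"
    using exists_maximal_family[OF assms, of ?V] by auto
  let ?G = "Hypergraph ?V (shadow k F)"
  have G: "uniform_hypergraph k ?G" "card (verts ?G) = n"
    using F(1) by (auto simp: uniform_hypergraph_def shadow_def)
  have "finite (clique_verts k t ?G)"
    by (auto simp: clique_verts_def intro: finite_subset[of _ "Pow ?V"])
  moreover have "F \<subseteq> clique_verts k t ?G"
    using F(1) by (auto simp: clique_verts_def shadow_def)
  ultimately have "card F \<le> card (clique_verts k t ?G)" by (rule card_mono)
  also have "\<dots> = card (copies (clique k t) ?G)" using assms by (simp add: card_copies_clique)
  also have "\<dots> \<le> ex_num k n (clique k t) (suspension k (cycle_graph l))"
    using G F(2) free_of_suspension_iff[OF G(1)] assms by (intro ex_num_ge) auto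
  finally have "(d + 2 ^ t * n ^ (t - k + 1)) * card F \<le>
      (d + 2 ^ t * n ^ (t - k + 1)) * ex_num k n (clique k t) (suspension k (cycle_graph l))"
    by (rule mult_le_mono2)
  then show ?thesis using F(3) by linarith
qed

section \<open>Asymptotics\<close>

text \<open>With \<open>d\<close> about \<open>c * r n\<close>, the sets that would close a cycle
  are at most half of the main term \<open>n ^ t / t ^ t\<close>. What is left forces
  \<open>X n\<close> to be at least of order \<open>d * n ^ (k - 1)\<close>.\<close>

lemma ex_num_clique_lower:
  assumes "2 \<le> k" "3 \<le> l" "k \<le> t" "t < k + l - 2"
  shows "(\<lambda>n. real (ex_num k n (clique k t) (suspension k (cycle_graph l))))
           \<in> \<Omega>(\<lambda>n. real n powr (real k - 1 + 1 / (real l - 1)))"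
proof -
  \<comment> \<open>Chosen so that \<open>l * t ^ (l - 1) * c\<close> equals
    \<open>1 / (2 * t ^ t)\<close>, half of the constant in the lower bound for the binomial
    coefficient.\<close>
  define c where "c = 1 / (2 * real l * real t ^ (l - 1) * real t ^ t)"
  define r where "r n = real n powr (1 / (real l - 1))" for n
  define X where "X n = real (ex_num k n (clique k t) (suspension k (cycle_graph l)))" for n
  have t: "t \<ge> 2" using assms by simp
  have c: "0 < c" "c \<le> 1"
  proof -
    have "1 * 1 * 1 * 1 \<le> 2 * real l * real t ^ (l - 1) * real t ^ t"
      using assms t by (intro mult_mono one_le_power) auto
    then show "0 < c" "c \<le> 1" by (auto simp: c_def field_simps)
  qed
  have "1 / c \<le> r n" if n: "n \<ge> nat \<lceil>(1 / c) ^ (l - 1)\<rceil>" for n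
  proof -
    have "(1 / c) ^ (l - 1) = (1 / c) powr real (l - 1)" using c by (subst powr_realpow) auto
    then have "1 / c = ((1 / c) ^ (l - 1)) powr (1 / (real l - 1))"
      using assms c by (simp add: powr_powr of_nat_diff)
    also have "\<dots> \<le> r n"
      unfolding r_def using n c assms by (intro powr_mono2) (auto simp: nat_le_iff ceiling_le_iff)
    finally show ?thesis .
  qed
  then have "eventually (\<lambda>n. 1 / c \<le> r n) sequentially"
    using eventually_at_top_linorder by blast
  \<comment> \<open>In \<open>2 ^ (t + 3)\<close>, the factor \<open>2 ^ (t + 1)\<close> bounds
    \<open>1 + 2 ^ t\<close>, one 2 pays for rounding in \<open>d\<close>, and one for the half of
    the main term that is given up.\<close>
  then have "eventually (\<lambda>n. X n \<ge> c / (2 ^ (t + 3) * real t ^ t) *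
      real n powr (real k - 1 + 1 / (real l - 1))) sequentially"
    using eventually_ge_at_top[of t]
  proof eventually_elim
    case (elim n)
    define d where "d = nat \<lfloor>c * r n\<rfloor>"
    have n1: "n \<ge> 1" using elim t by simp
    have cr: "1 \<le> c * r n" using elim c by (simp add: field_simps)
    have "real d = of_int \<lfloor>c * r n\<rfloor>" using cr by (simp add: d_def)
    then have d: "real d \<le> c * r n" "c * r n < real d + 1" using floor_correct[of "c * r n"] by linarith+
    then have d1: "d \<ge> 1" using cr by linarith
    then have dlow: "c * r n / 2 \<le> real d" using d by simp
    have r0: "r n \<ge> 0" by (simp add: r_def)
    have rpow: "r n ^ (l - 1) = real n"
    proof -
      have "r n ^ (l - 1) = r n powr real (l - 1)"
        using n1 by (subst powr_realpow) (auto simp: r_def)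
      also have "\<dots> = real n" using assms n1 by (simp add: r_def powr_powr of_nat_diff)
      finally show ?thesis .
    qed
    have "r n = r n ^ 1" by simp
    also have "\<dots> \<le> r n ^ (l - 1)"
    proof (rule power_increasing)
      show "1 \<le> l - 1" using assms by simp
      show "1 \<le> r n" using n1 assms by (simp add: r_def ge_one_powr_ge_zero)
    qed
    finally have "r n \<le> real n" by (simp only: rpow)
    then have "real d \<le> real n" using d(1) c r0 mult_right_mono[of c 1 "r n"] by linarith
    then have "d \<le> n" by simp
    also have "n \<le> n ^ (t - k + 1)" using n1 by (intro self_le_power) auto
    finally have "real d \<le> real (n ^ (t - k + 1))" by (rule of_nat_mono)
    \<comment> \<open>This allows the coefficient \<open>d + 2 ^ t * n ^ (t - k + 1)\<close> to be
      bounded by a multiple of \<open>n ^ (t - k + 1)\<close> alone.\<close>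
    then have dn: "real d \<le> real n ^ (t - k + 1)" by (simp only: of_nat_power)
    have dl: "real d ^ (l - 1) \<le> c * real n"
    proof -
      have "real d ^ (l - 1) \<le> (c * r n) ^ (l - 1)" using d by (intro power_mono) auto
      also have "\<dots> = c ^ (l - 1) * real n" by (simp only: power_mult_distrib rpow)
      also have "c ^ (l - 1) \<le> c ^ 1" using c assms by (intro power_decreasing) auto
      finally show ?thesis by (simp add: mult_right_mono)
    qed
    have tt: "real n ^ t = real n ^ (t - 1) * real n"
      using t by (cases t) auto
    have lt: "real l * (real d * real t) ^ (l - 1) * real n ^ (t - 1) \<le> real n ^ t / (2 * real t ^ t)"
    proof -
      have "real l * (real d * real t) ^ (l - 1) * real n ^ (t - 1)
          = real l * real t ^ (l - 1) * real n ^ (t - 1) * real d ^ (l - 1)"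
        by (simp add: power_mult_distrib mult_ac)
      also have "\<dots> \<le> real l * real t ^ (l - 1) * real n ^ (t - 1) * (c * real n)"
        using dl by (intro mult_left_mono) auto
      also have "\<dots> = real l * real t ^ (l - 1) * c * real n ^ t"
        by (simp add: tt mult_ac)
      also have "real l * real t ^ (l - 1) * c = 1 / (2 * real t ^ t)"
        using assms t by (simp add: c_def field_simps)
      finally show ?thesis by simp
    qed
    have "(real n / real t) ^ t \<le> real (n choose t)"
      using elim by (intro binomial_ge_n_over_k_pow_k)
    then have "real d * (real n ^ t / real t ^ t) \<le> real d * real (n choose t)"
      by (intro mult_left_mono) (auto simp: power_divide)
    also have "\<dots> = real (d * (n choose t))" by simp
    also have "\<dots> \<le> real ((d + 2 ^ t * n ^ (t - k + 1)) *
        ex_num k n (clique k t) (suspension k (cycle_graph l)) +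
        d * (l * (d * t) ^ (l - 1) * n ^ (t - 1)))"
      by (rule of_nat_mono[OF ex_num_clique_ge[OF assms d1]])
    also have "\<dots> = (real d + 2 ^ t * real n ^ (t - k + 1)) * X n +
        real d * (real l * (real d * real t) ^ (l - 1) * real n ^ (t - 1))"
      by (simp add: X_def)
    also have "\<dots> \<le> (real n ^ (t - k + 1) + 2 ^ t * real n ^ (t - k + 1)) * X n +
        real d * (real n ^ t / (2 * real t ^ t))"
      using dn lt by (intro add_mono mult_right_mono mult_left_mono) (auto simp: X_def)
    finally have le: "real d * (real n ^ t / real t ^ t) \<le>
        (real n ^ (t - k + 1) + 2 ^ t * real n ^ (t - k + 1)) * X n +
        real d * (real n ^ t / (2 * real t ^ t))" .
    have half: "a \<le> b" if "2 * a \<le> b + a" for a b :: real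
      using that by simp
    have eq: "real d * (real n ^ t / real t ^ t) = 2 * (real d * (real n ^ t / (2 * real t ^ t)))"
      by simp
    \<comment> \<open>The error term is half of the left side, so it is absorbed there.\<close>
    have "real d * (real n ^ t / (2 * real t ^ t)) \<le>
        (real n ^ (t - k + 1) + 2 ^ t * real n ^ (t - k + 1)) * X n"
      by (rule half[OF ord_eq_le_trans[OF eq[symmetric] le]])
    also have "\<dots> = (1 + 2 ^ t) * real n ^ (t - k + 1) * X n" by (simp add: algebra_simps)
    also have "\<dots> \<le> 2 ^ (t + 1) * real n ^ (t - k + 1) * X n"
      by (intro mult_right_mono) (auto simp: X_def)
    also have "\<dots> = real n ^ (t - k + 1) * (2 ^ (t + 1) * X n)" by (simp only: mult_ac)
    finally have le2: "real d * (real n ^ t / (2 * real t ^ t)) \<le>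
      real n ^ (t - k + 1) * (2 ^ (t + 1) * X n)" .
    have "t = (t - k + 1) + (k - 1)" using assms by simp
    then have split: "real n ^ t = real n ^ (t - k + 1) * real n ^ (k - 1)"
      by (metis power_add)
    have "real n ^ (t - k + 1) * (real d * real n ^ (k - 1) / (2 * real t ^ t)) \<le>
        real n ^ (t - k + 1) * (2 ^ (t + 1) * X n)"
      using le2 unfolding split by (simp only: mult_ac times_divide_eq_right)
    then have "real d * real n ^ (k - 1) / (2 * real t ^ t) \<le> 2 ^ (t + 1) * X n"
      by (rule mult_left_le_imp_le) (use n1 in simp)
    moreover have "c * r n / 2 * real n ^ (k - 1) / (2 * real t ^ t)
        \<le> real d * real n ^ (k - 1) / (2 * real t ^ t)"
      using dlow by (intro divide_right_mono mult_right_mono) auto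
    ultimately have "c * r n / 2 * real n ^ (k - 1) / (2 * real t ^ t) \<le> 2 ^ (t + 1) * X n"
      by linarith
    then have "c / (2 ^ (t + 3) * real t ^ t) * (r n * real n ^ (k - 1)) \<le> X n"
      using t by (simp add: field_simps power_add)
    also have "r n * real n ^ (k - 1) = r n * real n powr real (k - 1)"
      using n1 by (subst powr_realpow) auto
    also have "\<dots> = real n powr (real k - 1 + 1 / (real l - 1))"
      using assms by (simp add: r_def of_nat_diff add.commute flip: powr_add)
    finally show ?case .
  qed
  moreover have "c / (2 ^ (t + 3) * real t ^ t) > 0" using c t by simp
  ultimately show ?thesis
    unfolding X_def by (intro landau_omega.bigI[of "c / (2 ^ (t + 3) * real t ^ t)"]) auto
qed

theorem proposition3:
  fixes k l t :: nat
  assumes "k \<ge> 2" and "l \<ge> 3" and "k \<le> t" and "t < k + l - 2"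
  shows "(\<lambda>n. real (ex_num k n (clique k t) (suspension k (cycle_graph l))))
           \<in> \<Omega>(\<lambda>n. real n powr (real k - 1 + 1 / (real l - 1))) \<and>
         (odd l \<longrightarrow>
           (\<lambda>n. real (ex_num k n (clique k t) (suspension k (cycle_graph l))))
             \<in> O(\<lambda>n. real n ^ k)) \<and>
         (even l \<longrightarrow>
           (\<lambda>n. real (ex_num k n (clique k t) (suspension k (cycle_graph l))))
             \<in> O(\<lambda>n. real n powr (real k - 1 + 2 / real l)))"
proof (intro conjI impI)
  show "(\<lambda>n. real (ex_num k n (clique k t) (suspension k (cycle_graph l))))
      \<in> \<Omega>(\<lambda>n. real n powr (real k - 1 + 1 / (real l - 1)))"
    using ex_num_clique_lower[OF assms] .
  have "real (ex_num k n (clique k t) (suspension k (cycle_graph l))) \<le> 2 ^ l * real n ^ k" for n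
    using of_nat_mono[OF ex_num_clique_le_power[OF assms, of n], where 'a = real] by simp
  then show "(\<lambda>n. real (ex_num k n (clique k t) (suspension k (cycle_graph l))))
      \<in> O(\<lambda>n. real n ^ k)"
    by (intro bigoI[of _ "2 ^ l"]) auto
  assume "even l"
  then obtain m where m: "l = 2 * m" by blast
  have "eventually (\<lambda>n. real (ex_num k n (clique k t) (suspension k (cycle_graph l)))
      \<le> 2 ^ (2 * m) * 28 * m * real n powr (real k - 1 + 2 / real l)) at_top"
    using eventually_ge_at_top[of 1]
    by eventually_elim (use ex_num_clique_le_even[of k m t] assms m in simp)
  then show "(\<lambda>n. real (ex_num k n (clique k t) (suspension k (cycle_graph l))))
      \<in> O(\<lambda>n. real n powr (real k - 1 + 2 / real l))"
    by (intro bigoI[of _ "2 ^ (2 * m) * 28 * m"]) (auto elim!: eventually_mono)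
qed

end
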